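(* Let $d=1$, let the environment satisfy the standing assumptions (A1)–(A3) of the context, and suppose that $p(x)+p(x+1)=1$ for some $x\in\mathbb{Z}$. Then the fixed-time occupation variables in the stationary process are uncorrelated: $$\mathrm{Cov}_{\mathbb{P}}[f(\omega),f(T_{m,0}\omega)]=0\qquad\text{for all } m\in\mathbb{Z}\setminus\{0\}.$$
   Context: Environment (dimension $d=1$). Fix a finite constant $R$. An environment is $\omega=(\omega_{x,s})_{(x,s)\in\mathbb{Z}\times\mathbb{Z}}$ where each $\omega_{x,s}=(\omega_{x,s}(z):z\in\mathbb{Z},|z|\le R)$ is a probability vector. $\Omega$ is the space of environments with product topology and Borel $\sigma$-algebra, and $(T_{x,s}\omega)_{y,t}=\omega_{x+y,s+t}$. One-step transition probabilities are $\pi^\omega_{s,s+1}(x,y)=\omega_{x,s}(y-x)$ (zero if $|y-x|>R$), and $\pi^\omega_{s,t}(x,y)$ denotes the multistep transition probability obtained by composing one-step transitions. $\mathbb{P}$ is a probability measure on $\Omega$ with expectation $\mathbb{E}$. Let $p(u)=\mathbb{E}[\omega_{0,0}(u)]$. Standing assumptions. (A1) The vectors $(\omega_{x,s})_{(x,s)}$ are i.i.d. under $\mathbb{P}$. (A2) $\mathbb{P}\{\exists z\in\mathbb{Z}: 0<\omega_{0,0}(z)<1\}>0$. (A3) There do not exist $x\in\mathbb{Z}$ and an additive subgroup $\mathbb{G}\subsetneq\mathbb{Z}$ such that $\sum_{z\in\mathbb{G}}p(x+z)=1$. Density $f$. Set $f_N(\omega)=\sum_{z\in\mathbb{Z}}\pi^\omega_{-N,0}(z,0)$,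 a nonnegative martingale in $N$, and $f=\lim_{N\to\infty}f_N$ ($\mathbb{P}$-a.s.). It satisfies $\mathbb{E}f=1$ and $\mathbb{E}(f^2)<\infty$. Link to occupation variables: let $\mu^\rho=\int\mu^{\rho,\omega}\,\mathbb{P}(d\omega)$, where under $\mu^{\rho,\omega}$ the variables $\eta(x)$, $x\in\mathbb{Z}$, are independent Poisson with means $\rho f(T_{x,0}\omega)$; this is the stationary distribution of the occupation process, and $\mathrm{Cov}^{\mu^\rho}[\eta(0),\eta(m)]=\rho^2\,\mathrm{Cov}_{\mathbb{P}}[f(\omega),f(T_{m,0}\omega)]$ for $m\neq0$. *)

theory Defs
  imports "HOL-Probability.Probability" "HOL-Algebra.Elementary_Groups"
begin

text \<open>An environment assigns to each space-time point \<open>(x, s)\<close> a probability vector on the jumps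
  \<open>z\<close> with \<open>\<bar>z\<bar> \<le> R\<close>. Vectors are extended by zero to all of \<open>int\<close>.\<close>

type_synonym environment = "int \<times> int \<Rightarrow> int \<Rightarrow> real"

definition prob_vectors :: "nat \<Rightarrow> (int \<Rightarrow> real) set" where
  "prob_vectors R =
     {v. (\<forall>z. 0 \<le> v z) \<and> (\<forall>z. int R < \<bar>z\<bar> \<longrightarrow> v z = 0) \<and> (\<Sum>z = - int R..int R. v z) = 1}"

definition environments :: "nat \<Rightarrow> environment set" where
  "environments R = {\<omega>. \<forall>x s. \<omega> (x, s) \<in> prob_vectors R}"

text \<open>Here \<open>borel\<close> refers to the product topology on the function type, so this is
  the Borel sigma-algebra of the subspace topology on the environments.\<close>

definition env_space :: "nat \<Rightarrow> environment measure" where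
  "env_space R = restrict_space borel (environments R)"

definition env_shift :: "int \<Rightarrow> int \<Rightarrow> environment \<Rightarrow> environment" where
  "env_shift x s \<omega> = (\<lambda>(y, t). \<omega> (x + y, s + t))"

definition one_step :: "environment \<Rightarrow> int \<Rightarrow> int \<Rightarrow> int \<Rightarrow> real" where
  "one_step \<omega> s x y = \<omega> (x, s) (y - x)"

text \<open>For environments in \<open>environments R\<close> the infinite sums below have only finitely many
  nonzero terms.\<close>

primrec n_step :: "environment \<Rightarrow> int \<Rightarrow> nat \<Rightarrow> int \<Rightarrow> int \<Rightarrow> real" where
  "n_step \<omega> s 0 x y = (if x = y then 1 else 0)"
| "n_step \<omega> s (Suc n) x y = (\<Sum>\<^sub>\<infinity>z. n_step \<omega> s n x z * one_step \<omega> (s + int n) z y)"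

text \<open>The transition probability from time \<open>s\<close> to time \<open>t\<close>, meant for \<open>s \<le> t\<close>.\<close>

definition trans_prob :: "environment \<Rightarrow> int \<Rightarrow> int \<Rightarrow> int \<Rightarrow> int \<Rightarrow> real" where
  "trans_prob \<omega> s t x y = n_step \<omega> s (nat (t - s)) x y"

definition mean_step :: "environment measure \<Rightarrow> int \<Rightarrow> real" where
  "mean_step P u = (\<integral>\<omega>. \<omega> (0, 0) u \<partial>P)"

definition iid_environment :: "environment measure \<Rightarrow> bool" where
  "iid_environment P \<longleftrightarrow>
     prob_space.indep_vars P (\<lambda>_. borel) (\<lambda>i \<omega>. \<omega> i) UNIV \<and>
     (\<forall>i. distr P borel (\<lambda>\<omega>. \<omega> i) = distr P borel (\<lambda>\<omega>. \<omega> (0, 0)))"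

definition random_environment :: "environment measure \<Rightarrow> bool" where
  "random_environment P \<longleftrightarrow>
     measure P {\<omega> \<in> space P. \<exists>z. 0 < \<omega> (0, 0) z \<and> \<omega> (0, 0) z < 1} > 0"

definition aperiodic_walk :: "environment measure \<Rightarrow> bool" where
  "aperiodic_walk P \<longleftrightarrow>
     \<not> (\<exists>x G. subgroup G integer_group \<and> G \<noteq> UNIV \<and> (\<Sum>\<^sub>\<infinity>z\<in>G. mean_step P (x + z)) = 1)"

definition density_approx :: "nat \<Rightarrow> environment \<Rightarrow> real" where
  "density_approx N \<omega> = (\<Sum>\<^sub>\<infinity>z. trans_prob \<omega> (- int N) 0 z 0)"

text \<open>Under the standing assumptions the limit exists almost surely;
  off that event the value of \<open>lim\<close> is an arbitrary constant.\<close>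

definition env_density :: "environment \<Rightarrow> real" where
  "env_density \<omega> = lim (\<lambda>N. density_approx N \<omega>)"

definition covariance :: "'a measure \<Rightarrow> ('a \<Rightarrow> real) \<Rightarrow> ('a \<Rightarrow> real) \<Rightarrow> real" where
  "covariance M X Y = (\<integral>\<omega>. (X \<omega> - (\<integral>\<xi>. X \<xi> \<partial>M)) * (Y \<omega> - (\<integral>\<xi>. Y \<xi> \<partial>M)) \<partial>M)"

end

theory Submission
  imports Defs
begin

text \<open>
  Since the mean jump probabilities of \<open>x\<close> and \<open>x + 1\<close> add up to 1, almost every environment jumps by
  \<open>x\<close> or \<open>x + 1\<close> at every site. Write \<open>a\<close> for the probability of \<open>x + 1\<close> at a site; these
  variables are i.i.d. with values in \<open>[0, 1]\<close>, mean \<open>q\<close> and second moment \<open>v\<close>, and \<open>v < q\<close> by the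
  randomness of the environment. Put unit mass on every site at time \<open>-N\<close>. Then \<open>f\<^sub>N(T\<^sub>y \<omega>)\<close> is the mass
  found at \<open>y\<close> at time 0.

  The correlations \<open>c\<^sub>N(m) = E[f\<^sub>N f\<^sub>N(T\<^sub>m)]\<close> satisfy a closed linear recursion
  (\<open>pair_correlation\<close>): the layers of the environment are independent, and two sites at the new
  time receive mass from at most four sites at the old one. It reads \<open>c\<^sub>N\<^sub>+\<^sub>1 = c\<^sub>N + \<Delta>(k c\<^sub>N)\<close>, where \<open>\<Delta>\<close>
  is the discrete Laplacian and \<open>k(m)\<close> is \<open>q(1 - q)\<close> for \<open>m \<noteq> 0\<close> and \<open>q - v\<close> for \<open>m = 0\<close>. Hence
  \<open>q(1 - q) / k\<close> is a stationary solution, and it equals 1 at every \<open>m \<noteq> 0\<close>: in the stationary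
  state the randomness of the environment shows up in the variance only. Nearest-neighbour
  jumps are what makes this work, because then \<open>k\<close> is the only coefficient and it sits inside the
  Laplacian.

  The recursion converges to this solution (\<open>pair_corr_tendsto_1\<close>). The difference is non-negative
  and has a conserved finite total. At the origin it decreases, because \<open>f\<^sub>N\<close> is a martingale; the
  recursion spreads the limit at the origin to all other sites, and a constant with finite sum over
  the integers vanishes.

  It remains to exchange limit and expectation. The stationary solution bounds the second moments of
  the martingale \<open>f\<^sub>N\<close>, so \<open>f\<^sub>N\<close> converges almost surely and in \<open>L\<^sup>2\<close> (\<open>AE_convergent\<close>, \<open>L2_limit\<close>).
  Therefore \<open>E f = 1\<close> and \<open>E[f f(T\<^sub>m)] = lim c\<^sub>N(m) = 1\<close> for \<open>m \<noteq> 0\<close>, and the covariance is \<open>1 - 1\<close>.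
\<close>

section \<open>The recursion for the pair correlations\<close>

text \<open>In the application this is the probability, averaged over the environment, that of two walkers at
  distance \<open>m\<close> the first one makes the lower and the second one the upper jump. Two walkers on one
  site use the same environment vector, which changes the value at \<open>m = 0\<close>.\<close>

definition jump_rate :: "real \<Rightarrow> real \<Rightarrow> int \<Rightarrow> real" where
  "jump_rate \<alpha> \<beta> m = (if m = 0 then \<alpha> else \<beta>)"

text \<open>The second moments of the mass process obey this recursion (\<open>pair_correlation\<close> below); the initial
  value 1 is the unit mass on every site.\<close>

primrec pair_corr :: "(int \<Rightarrow> real) \<Rightarrow> nat \<Rightarrow> int \<Rightarrow> real" where
  "pair_corr k 0 m = 1"
| "pair_corr k (Suc n) m = (1 - 2 * k m) * pair_corr k n m
     + k (m - 1) * pair_corr k n (m - 1) + k (m + 1) * pair_corr k n (m + 1)"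

text \<open>The recursion reads \<open>c\<^sub>n\<^sub>+\<^sub>1 = c\<^sub>n + \<Delta>(k c\<^sub>n)\<close> with the discrete Laplacian \<open>\<Delta>\<close>, so a multiple of
  \<open>1 / k\<close> is stationary. The multiple with value 1 off the origin is \<open>\<beta> / k\<close>; the deficit
  measures how far the correlations still are from it.\<close>

definition corr_deficit :: "real \<Rightarrow> real \<Rightarrow> nat \<Rightarrow> int \<Rightarrow> real" where
  "corr_deficit \<alpha> \<beta> n m = \<beta> / jump_rate \<alpha> \<beta> m - pair_corr (jump_rate \<alpha> \<beta>) n m"

context
  fixes \<alpha> \<beta> :: real
  assumes \<alpha>_pos: "0 < \<alpha>" and \<alpha>_le_\<beta>: "\<alpha> \<le> \<beta>" and \<beta>_le_half: "\<beta> \<le> 1 / 2"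
begin

private abbreviation (input) "D \<equiv> corr_deficit \<alpha> \<beta>"
private abbreviation (input) "k \<equiv> jump_rate \<alpha> \<beta>"

lemma jump_rate_bounds: "0 < k m" "2 * k m \<le> 1"
  using \<alpha>_pos \<alpha>_le_\<beta> \<beta>_le_half by (auto simp: jump_rate_def)

text \<open>The stationary part drops out because \<open>k * (\<beta> / k)\<close> is constant, hence has Laplacian 0.\<close>

lemma corr_deficit_Suc:
  "D (Suc n) m = D n m + (k (m - 1) * D n (m - 1) - 2 * (k m * D n m) + k (m + 1) * D n (m + 1))"
proof -
  have "k j * (\<beta> / k j) = \<beta>" for j
    using jump_rate_bounds(1)[of j] by simp
  then have "k j * D n j = \<beta> - k j * pair_corr k n j" for j
    by (simp add: corr_deficit_def right_diff_distrib)
  then show ?thesis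
    by (simp add: corr_deficit_def algebra_simps)
qed

text \<open>Grouping the terms by \<open>D n m\<close> leaves the coefficient \<open>1 - 2 * k m\<close>, so the bound on the rates makes the
  evolution of the deficit positivity preserving.\<close>

lemma corr_deficit_nonneg: "0 \<le> D n m"
proof (induction n arbitrary: m)
  case 0
  show ?case
    using \<alpha>_pos \<alpha>_le_\<beta> by (simp add: corr_deficit_def jump_rate_def)
next
  case (Suc n)
  have "D (Suc n) m = (1 - 2 * k m) * D n m + k (m - 1) * D n (m - 1) + k (m + 1) * D n (m + 1)"
    by (simp add: corr_deficit_Suc algebra_simps)
  also have "\<dots> \<ge> 0"
    using Suc.IH jump_rate_bounds by (intro add_nonneg_nonneg mult_nonneg_nonneg) (auto simp: less_imp_le)
  finally show ?case .
qed

lemma corr_deficit_eq_0: "int n < \<bar>m\<bar> \<Longrightarrow> D n m = 0"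
proof (induction n arbitrary: m)
  case 0
  then show ?case
    using \<alpha>_pos \<alpha>_le_\<beta> by (simp add: corr_deficit_def jump_rate_def)
next
  case (Suc n)
  then have "D n m = 0" "D n (m - 1) = 0" "D n (m + 1) = 0"
    by (intro Suc.IH; linarith)+
  then show ?case
    by (simp add: corr_deficit_Suc)
qed

lemma corr_deficit_minus: "D n (- m) = D n m"
proof (induction n arbitrary: m)
  case 0
  show ?case by (simp add: corr_deficit_def jump_rate_def)
next
  case (Suc n)
  have "k (- j) = k j" for j
    by (simp add: jump_rate_def)
  then have *: "k (- j) * D n (- j) = k j * D n j" for j
    by (simp add: Suc.IH)
  show ?case
    using *[of "m + 1"] *[of "m - 1"] *[of m]
    by (simp add: corr_deficit_Suc Suc.IH)
qed

text \<open>Summing a Laplacian over a symmetric window telescopes to the flux through the two ends, which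
  are equal by symmetry; this is why only half of the window is summed.\<close>

lemma corr_deficit_flux:
  "D (Suc n) 0 + 2 * (\<Sum>m=1..L. D (Suc n) (int m)) =
     D n 0 + 2 * (\<Sum>m=1..L. D n (int m))
       + 2 * (k (int L + 1) * D n (int L + 1) - k (int L) * D n (int L))"
proof (induction L)
  case 0
  have "k (- 1) * D n (- 1) = k 1 * D n 1"
    using corr_deficit_minus[of n 1] by (simp add: jump_rate_def)
  then show ?case
    by (simp add: corr_deficit_Suc algebra_simps)
next
  case (Suc L)
  have "D (Suc n) (int (Suc L)) = D n (int (Suc L)) + (k (int L) * D n (int L)
      - 2 * (k (int L + 1) * D n (int L + 1)) + k (int (Suc L) + 1) * D n (int (Suc L) + 1))"
    unfolding corr_deficit_Suc by (simp add: algebra_simps)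
  with Suc.IH show ?case
    by (simp add: algebra_simps)
qed

text \<open>The total deficit is conserved: no flux crosses the ends of a window that still contains the
  support. The initial deficit sits at the origin only.\<close>

lemma corr_deficit_total:
  "n \<le> L \<Longrightarrow> D n 0 + 2 * (\<Sum>m=1..L. D n (int m)) = \<beta> / \<alpha> - 1"
proof (induction n)
  case 0
  have "D 0 (int m) = 0" if "m \<in> {1..L}" for m
    using that by (intro corr_deficit_eq_0) auto
  then show ?case
    by (simp add: corr_deficit_def jump_rate_def)
next
  case (Suc n)
  have "D n (int L) = 0" "D n (int L + 1) = 0"
    using Suc.prems by (auto intro: corr_deficit_eq_0)
  with Suc show ?case
    using corr_deficit_flux[of n L] by simp
qed

lemma corr_deficit_sum_le: "(\<Sum>m=1..L. D n (int m)) \<le> \<beta> / \<alpha> - 1"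
proof -
  \<comment> \<open>The conserved total is available only for windows that contain the support.\<close>
  define L' where "L' = max n L"
  have "(\<Sum>m=1..L. D n (int m)) \<le> (\<Sum>m=1..L'. D n (int m))"
    by (intro sum_mono2) (auto simp: L'_def corr_deficit_nonneg)
  also have "\<dots> \<le> D n 0 + 2 * (\<Sum>m=1..L'. D n (int m))"
    using corr_deficit_nonneg[of n 0] sum_nonneg[of "{1..L'}" "\<lambda>m. D n (int m)"]
    by (simp add: corr_deficit_nonneg)
  also have "\<dots> = \<beta> / \<alpha> - 1"
    by (rule corr_deficit_total) (simp add: L'_def)
  finally show ?thesis .
qed

lemma pair_corr_0_le: "pair_corr k n 0 \<le> \<beta> / \<alpha>"
  using corr_deficit_nonneg[of n 0] by (simp add: corr_deficit_def jump_rate_def)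

text \<open>At the origin the deficit decreases, hence converges to some \<open>d\<close>. The recursion, solved for its
  outermost term, carries the convergence of \<open>k * D\<close> from \<open>j\<close> and \<open>j + 1\<close> to \<open>j + 2\<close>, always with the
  same limit \<open>\<alpha> * d\<close>. Off the origin the deficits therefore all tend to one constant, and their sum
  stays bounded by the conserved total, so this constant is 0.\<close>

lemma pair_corr_tendsto_1:
  assumes mono: "\<And>n. pair_corr k n 0 \<le> pair_corr k (Suc n) 0" and "m \<noteq> 0"
  shows "(\<lambda>n. pair_corr k n m) \<longlonglongrightarrow> 1"
proof -
  have "decseq (\<lambda>n. D n 0)"
    using mono unfolding corr_deficit_def by (intro decseq_SucI diff_left_mono)
  then obtain d where d: "(\<lambda>n. D n 0) \<longlonglongrightarrow> d"
    by (rule decseq_convergent[where B = 0]) (auto simp: corr_deficit_nonneg)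
  have "d \<ge> 0"
    using d by (rule LIMSEQ_le_const) (simp add: corr_deficit_nonneg)
  have conv: "(\<lambda>n. k (int m) * D n (int m)) \<longlonglongrightarrow> \<alpha> * d" for m
  proof (induction m rule: less_induct)
    case (less m)
    consider "m = 0" | "m = 1" | j where "m = Suc (Suc j)"
      by (metis One_nat_def not0_implies_Suc)
    then show ?case
    proof cases
      case 1
      then show ?thesis
        using tendsto_mult_left[OF d, of \<alpha>] by (simp add: jump_rate_def)
    next
      case 2
      \<comment> \<open>At the origin both neighbours contribute equally by symmetry, hence the division by 2.\<close>
      have "(\<lambda>n. (D (Suc n) 0 - D n 0) / 2 + \<alpha> * D n 0) \<longlonglongrightarrow> (d - d) / 2 + \<alpha> * d"
        by (intro tendsto_intros d LIMSEQ_Suc) simp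
      moreover have "(D (Suc n) 0 - D n 0) / 2 + \<alpha> * D n 0 = k (int m) * D n (int m)" for n
        using corr_deficit_minus[of n 1] 2 by (simp add: corr_deficit_Suc jump_rate_def field_simps)
      ultimately show ?thesis by simp
    next
      case 3
      let ?e = "\<lambda>j n. k (int j) * D n (int j)"
      have IH: "?e j \<longlonglongrightarrow> \<alpha> * d" "?e (Suc j) \<longlonglongrightarrow> \<alpha> * d"
        using 3 less.IH[of j] less.IH[of "Suc j"] by simp_all
      have "(\<lambda>n. ?e (Suc j) n / k (int (Suc j))) \<longlonglongrightarrow> \<alpha> * d / k (int (Suc j))"
        using jump_rate_bounds(1)[of "int (Suc j)"] by (intro tendsto_intros IH) simp
      then have D: "(\<lambda>n. D n (int (Suc j))) \<longlonglongrightarrow> \<alpha> * d / k (int (Suc j))"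
        using jump_rate_bounds(1)[of "int (Suc j)"] by simp
      have "(\<lambda>n. D (Suc n) (int (Suc j)) - D n (int (Suc j)) + 2 * ?e (Suc j) n - ?e j n)
          \<longlonglongrightarrow> \<alpha> * d / k (int (Suc j)) - \<alpha> * d / k (int (Suc j)) + 2 * (\<alpha> * d) - \<alpha> * d"
        by (intro tendsto_intros IH D LIMSEQ_Suc[OF D])
      moreover have "D (Suc n) (int (Suc j)) - D n (int (Suc j)) + 2 * ?e (Suc j) n - ?e j n = ?e m n" for n
        using 3 by (simp add: corr_deficit_Suc algebra_simps)
      ultimately show ?thesis by simp
    qed
  qed
  have D: "(\<lambda>n. D n m) \<longlonglongrightarrow> \<alpha> * d / \<beta>" if "m \<noteq> 0" for m
  proof -
    have "(\<lambda>n. k (int (nat \<bar>m\<bar>)) * D n (int (nat \<bar>m\<bar>)) / \<beta>) \<longlonglongrightarrow> \<alpha> * d / \<beta>"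
      using \<alpha>_pos \<alpha>_le_\<beta> by (intro tendsto_intros conv) simp
    moreover have "D n (int (nat \<bar>m\<bar>)) = D n m" for n
      using corr_deficit_minus[of n m] by (cases "m \<ge> 0") auto
    ultimately show ?thesis
      using that \<alpha>_pos \<alpha>_le_\<beta> by (simp add: jump_rate_def)
  qed
  have "real L * (\<alpha> * d / \<beta>) \<le> \<beta> / \<alpha> - 1" for L
  proof -
    have "(\<lambda>n. \<Sum>m=1..L. D n (int m)) \<longlonglongrightarrow> (\<Sum>m=1..L. \<alpha> * d / \<beta>)"
      by (intro tendsto_sum D) auto
    then have "(\<Sum>m=1..L. \<alpha> * d / \<beta>) \<le> \<beta> / \<alpha> - 1"
      using corr_deficit_sum_le by (intro LIMSEQ_le_const2) blast+
    then show ?thesis by simp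
  qed
  moreover have "\<exists>L. \<beta> / \<alpha> - 1 < real L * (\<alpha> * d / \<beta>)" if "0 < \<alpha> * d / \<beta>"
    using reals_Archimedean3[OF that] by blast
  moreover have "0 \<le> \<alpha> * d / \<beta>"
    using \<open>d \<ge> 0\<close> \<alpha>_pos \<alpha>_le_\<beta> by simp
  ultimately have "\<alpha> * d / \<beta> = 0"
    by (meson less_le not_le)
  with D[OF \<open>m \<noteq> 0\<close>] have "(\<lambda>n. 1 - D n m) \<longlonglongrightarrow> 1 - 0"
    by (intro tendsto_intros) auto
  then show ?thesis
    using \<open>m \<noteq> 0\<close> \<alpha>_pos \<alpha>_le_\<beta> by (simp add: corr_deficit_def jump_rate_def)
qed

end

section \<open>Square-integrable limits\<close>

context prob_space
begin

text \<open>The second moment of \<open>U - t V\<close> is a quadratic in \<open>t\<close> that is nowhere negative; the choice \<open>t = c / b\<close>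
  below is its minimum point.\<close>

lemma Cauchy_Schwarz_expectation:
  fixes U V :: "'a \<Rightarrow> real"
  assumes [measurable]: "U \<in> borel_measurable M" "V \<in> borel_measurable M"
    and U: "integrable M (\<lambda>\<omega>. (U \<omega>)\<^sup>2)" and V: "integrable M (\<lambda>\<omega>. (V \<omega>)\<^sup>2)"
  shows "integrable M (\<lambda>\<omega>. U \<omega> * V \<omega>)"
    and "\<bar>expectation (\<lambda>\<omega>. U \<omega> * V \<omega>)\<bar> \<le>
      sqrt (expectation (\<lambda>\<omega>. (U \<omega>)\<^sup>2)) * sqrt (expectation (\<lambda>\<omega>. (V \<omega>)\<^sup>2))"
proof -
  have "\<bar>U \<omega> * V \<omega>\<bar> \<le> (U \<omega>)\<^sup>2 + (V \<omega>)\<^sup>2" for \<omega>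
    using sum_squares_bound[of "\<bar>U \<omega>\<bar>" "\<bar>V \<omega>\<bar>"] mult_nonneg_nonneg[of "\<bar>U \<omega>\<bar>" "\<bar>V \<omega>\<bar>"]
    unfolding abs_mult power2_abs by linarith
  then show UV: "integrable M (\<lambda>\<omega>. U \<omega> * V \<omega>)"
    by (intro Bochner_Integration.integrable_bound[OF Bochner_Integration.integrable_add[OF U V]])
      (auto simp: abs_of_nonneg)
  define a b c where "a = expectation (\<lambda>\<omega>. (U \<omega>)\<^sup>2)" and "b = expectation (\<lambda>\<omega>. (V \<omega>)\<^sup>2)"
    and "c = expectation (\<lambda>\<omega>. U \<omega> * V \<omega>)"
  have ab: "0 \<le> a" "0 \<le> b"
    by (auto simp: a_def b_def)
  have quad: "0 \<le> a - 2 * t * c + t\<^sup>2 * b" for t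
  proof -
    have "(U \<omega> - t * V \<omega>)\<^sup>2 = (U \<omega>)\<^sup>2 - 2 * t * (U \<omega> * V \<omega>) + t\<^sup>2 * (V \<omega>)\<^sup>2" for \<omega>
      by (simp add: power2_eq_square algebra_simps)
    then have "expectation (\<lambda>\<omega>. (U \<omega> - t * V \<omega>)\<^sup>2) = a - 2 * t * c + t\<^sup>2 * b"
      using U V UV by (simp add: a_def b_def c_def)
    then show ?thesis
      using Bochner_Integration.integral_nonneg[of M "\<lambda>\<omega>. (U \<omega> - t * V \<omega>)\<^sup>2"] by simp
  qed
  have "c\<^sup>2 \<le> a * b"
  proof (cases "b = 0")
    case True
    have "c = 0"
    proof (rule ccontr)
      assume "c \<noteq> 0"
      then show False
        using quad[of "(a + 1) / (2 * c)"] True by simp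
    qed
    with True show ?thesis by simp
  next
    case False
    have "a - 2 * (c / b) * c + (c / b)\<^sup>2 * b = a - c\<^sup>2 / b"
      using False by (simp add: power2_eq_square)
    then have "c\<^sup>2 / b \<le> a"
      using quad[of "c / b"] by linarith
    then show ?thesis
      using False ab by (simp add: pos_divide_le_eq)
  qed
  then have "\<bar>c\<bar> \<le> sqrt (a * b)"
    using real_sqrt_le_mono by fastforce
  then show "\<bar>expectation (\<lambda>\<omega>. U \<omega> * V \<omega>)\<bar> \<le>
      sqrt (expectation (\<lambda>\<omega>. (U \<omega>)\<^sup>2)) * sqrt (expectation (\<lambda>\<omega>. (V \<omega>)\<^sup>2))"
    by (simp add: a_def b_def c_def real_sqrt_mult)
qed

lemma square_integrable_add:
  fixes U V :: "'a \<Rightarrow> real"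
  assumes [measurable]: "U \<in> borel_measurable M" "V \<in> borel_measurable M"
    and U: "integrable M (\<lambda>\<omega>. (U \<omega>)\<^sup>2)" and V: "integrable M (\<lambda>\<omega>. (V \<omega>)\<^sup>2)"
  shows "integrable M (\<lambda>\<omega>. (U \<omega> + V \<omega>)\<^sup>2)"
  using U V Cauchy_Schwarz_expectation(1)[OF assms] by (simp add: power2_sum mult.assoc)

text \<open>Expand the difference of the products around the limits; each of the three terms carries
  a factor that tends to zero in \<open>L\<^sup>2\<close>.\<close>

lemma expectation_product_tendsto:
  fixes X Y :: "nat \<Rightarrow> 'a \<Rightarrow> real"
  assumes [measurable]: "\<And>n. X n \<in> borel_measurable M" "\<And>n. Y n \<in> borel_measurable M"
      "X' \<in> borel_measurable M" "Y' \<in> borel_measurable M"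
    and X': "integrable M (\<lambda>\<omega>. (X' \<omega>)\<^sup>2)" and Y': "integrable M (\<lambda>\<omega>. (Y' \<omega>)\<^sup>2)"
    and iX: "\<And>n. integrable M (\<lambda>\<omega>. (X n \<omega> - X' \<omega>)\<^sup>2)"
    and iY: "\<And>n. integrable M (\<lambda>\<omega>. (Y n \<omega> - Y' \<omega>)\<^sup>2)"
    and X: "(\<lambda>n. expectation (\<lambda>\<omega>. (X n \<omega> - X' \<omega>)\<^sup>2)) \<longlonglongrightarrow> 0"
    and Y: "(\<lambda>n. expectation (\<lambda>\<omega>. (Y n \<omega> - Y' \<omega>)\<^sup>2)) \<longlonglongrightarrow> 0"
  shows "(\<lambda>n. expectation (\<lambda>\<omega>. X n \<omega> * Y n \<omega>)) \<longlonglongrightarrow> expectation (\<lambda>\<omega>. X' \<omega> * Y' \<omega>)"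
proof -
  have zero: "(\<lambda>n. expectation (\<lambda>\<omega>. U n \<omega> * V n \<omega>)) \<longlonglongrightarrow> 0"
    if m: "\<And>n. U n \<in> borel_measurable M" "\<And>n. V n \<in> borel_measurable M"
      and i: "\<And>n. integrable M (\<lambda>\<omega>. (U n \<omega>)\<^sup>2)" "\<And>n. integrable M (\<lambda>\<omega>. (V n \<omega>)\<^sup>2)"
      and U: "(\<lambda>n. expectation (\<lambda>\<omega>. (U n \<omega>)\<^sup>2)) \<longlonglongrightarrow> u" and V: "(\<lambda>n. expectation (\<lambda>\<omega>. (V n \<omega>)\<^sup>2)) \<longlonglongrightarrow> 0"
    for U V :: "nat \<Rightarrow> 'a \<Rightarrow> real" and u
  proof (rule tendsto_0_le[where K = 1])
    have "(\<lambda>n. sqrt (expectation (\<lambda>\<omega>. (U n \<omega>)\<^sup>2)) * sqrt (expectation (\<lambda>\<omega>. (V n \<omega>)\<^sup>2)))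
        \<longlonglongrightarrow> sqrt u * sqrt 0"
      by (intro tendsto_intros U V)
    then show "(\<lambda>n. sqrt (expectation (\<lambda>\<omega>. (U n \<omega>)\<^sup>2)) * sqrt (expectation (\<lambda>\<omega>. (V n \<omega>)\<^sup>2))) \<longlonglongrightarrow> 0"
      by simp
    show "\<forall>\<^sub>F n in sequentially. norm (expectation (\<lambda>\<omega>. U n \<omega> * V n \<omega>)) \<le>
        norm (sqrt (expectation (\<lambda>\<omega>. (U n \<omega>)\<^sup>2)) * sqrt (expectation (\<lambda>\<omega>. (V n \<omega>)\<^sup>2))) * 1"
      using Cauchy_Schwarz_expectation(2)[OF m i] by (auto simp: abs_mult)
  qed
  have ints: "integrable M (\<lambda>\<omega>. (X n \<omega> - X' \<omega>) * (Y n \<omega> - Y' \<omega>))"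
     "integrable M (\<lambda>\<omega>. X' \<omega> * (Y n \<omega> - Y' \<omega>))" "integrable M (\<lambda>\<omega>. Y' \<omega> * (X n \<omega> - X' \<omega>))" for n
    by (intro Cauchy_Schwarz_expectation(1) iX iY X' Y'; measurable)+
  have int: "integrable M (\<lambda>\<omega>. X' \<omega> * Y' \<omega>)"
    by (intro Cauchy_Schwarz_expectation(1) X' Y') measurable
  have eq: "expectation (\<lambda>\<omega>. X n \<omega> * Y n \<omega>) = expectation (\<lambda>\<omega>. (X n \<omega> - X' \<omega>) * (Y n \<omega> - Y' \<omega>))
      + expectation (\<lambda>\<omega>. X' \<omega> * (Y n \<omega> - Y' \<omega>)) + expectation (\<lambda>\<omega>. Y' \<omega> * (X n \<omega> - X' \<omega>))
      + expectation (\<lambda>\<omega>. X' \<omega> * Y' \<omega>)" for n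
  proof -
    have "X n \<omega> * Y n \<omega> = (X n \<omega> - X' \<omega>) * (Y n \<omega> - Y' \<omega>) + X' \<omega> * (Y n \<omega> - Y' \<omega>)
        + Y' \<omega> * (X n \<omega> - X' \<omega>) + X' \<omega> * Y' \<omega>" for \<omega>
      by (simp add: algebra_simps)
    then show ?thesis
      using ints[of n] int by simp
  qed
  have "(\<lambda>n. expectation (\<lambda>\<omega>. X n \<omega> * Y n \<omega>)) \<longlonglongrightarrow> 0 + 0 + 0 + expectation (\<lambda>\<omega>. X' \<omega> * Y' \<omega>)"
    unfolding eq
    by (intro tendsto_add tendsto_const zero[OF _ _ _ _ X Y] zero[OF _ _ _ _ tendsto_const Y]
        zero[OF _ _ _ _ tendsto_const X] iX iY X' Y') measurable
  then show ?thesis by simp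
qed

end

section \<open>Convergence of square-bounded martingales\<close>

text \<open>Bounded random variables known to a sub-sigma-algebra form an algebra, and all of them are
  integrable on a probability space; stating measurability and boundedness together gives both
  conclusions by one set of rules.\<close>

definition bounded_measurable :: "'a measure \<Rightarrow> ('a \<Rightarrow> real) \<Rightarrow> bool" where
  "bounded_measurable N X \<longleftrightarrow> X \<in> borel_measurable N \<and> (\<exists>B. \<forall>\<omega>\<in>space N. \<bar>X \<omega>\<bar> \<le> B)"

lemma bounded_measurable_const: "bounded_measurable N (\<lambda>_. c)"
  by (auto simp: bounded_measurable_def)

lemma bounded_measurable_add:
  assumes "bounded_measurable N X" "bounded_measurable N Y"
  shows "bounded_measurable N (\<lambda>\<omega>. X \<omega> + Y \<omega>)"
proof -
  obtain A B where "\<forall>\<omega>\<in>space N. \<bar>X \<omega>\<bar> \<le> A" "\<forall>\<omega>\<in>space N. \<bar>Y \<omega>\<bar> \<le> B"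
    using assms by (auto simp: bounded_measurable_def)
  then have "\<forall>\<omega>\<in>space N. \<bar>X \<omega> + Y \<omega>\<bar> \<le> A + B"
    by (meson abs_triangle_ineq add_mono order_trans)
  with assms show ?thesis by (auto simp: bounded_measurable_def)
qed

lemma bounded_measurable_mult:
  assumes "bounded_measurable N X" "bounded_measurable N Y"
  shows "bounded_measurable N (\<lambda>\<omega>. X \<omega> * Y \<omega>)"
proof -
  obtain A B where AB: "\<forall>\<omega>\<in>space N. \<bar>X \<omega>\<bar> \<le> A" "\<forall>\<omega>\<in>space N. \<bar>Y \<omega>\<bar> \<le> B"
    using assms by (auto simp: bounded_measurable_def)
  then have "\<forall>\<omega>\<in>space N. \<bar>X \<omega> * Y \<omega>\<bar> \<le> A * B"
    by (force simp: abs_mult intro!: mult_mono intro: order_trans[OF abs_ge_zero])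
  with assms show ?thesis by (auto simp: bounded_measurable_def)
qed

lemma bounded_measurable_diff:
  assumes "bounded_measurable N X" "bounded_measurable N Y"
  shows "bounded_measurable N (\<lambda>\<omega>. X \<omega> - Y \<omega>)"
  using bounded_measurable_add[OF assms(1) bounded_measurable_mult[OF bounded_measurable_const[of N "- 1"] assms(2)]]
  by simp

lemma bounded_measurable_square:
  "bounded_measurable N X \<Longrightarrow> bounded_measurable N (\<lambda>\<omega>. (X \<omega>)\<^sup>2)"
  by (simp add: power2_eq_square bounded_measurable_mult)

lemmas bounded_measurable_intros = bounded_measurable_const bounded_measurable_add
  bounded_measurable_mult bounded_measurable_diff bounded_measurable_square

lemma bounded_measurable_mono:
  assumes "bounded_measurable N X" "space N = space N'" "sets N \<subseteq> sets N'"
  shows "bounded_measurable N' X"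
proof -
  have "measurable N borel \<subseteq> measurable N' borel"
    using assms(2,3) by (intro measurable_mono) auto
  with assms show ?thesis
    by (auto simp: bounded_measurable_def)
qed

lemma (in prob_space) bounded_measurable_integrable:
  assumes "bounded_measurable M X" shows "integrable M X"
proof -
  obtain B where "\<forall>\<omega>\<in>space M. \<bar>X \<omega>\<bar> \<le> B"
    using assms by (auto simp: bounded_measurable_def)
  then show ?thesis
    using assms by (intro integrable_const_bound[where B = B]) (auto simp: bounded_measurable_def)
qed

text \<open>The martingale property enters as orthogonality of the next increment to everything bounded that is
  known at time \<open>n\<close>, which avoids conditional expectations. Each \<open>f n\<close> is bounded, but only the
  second moments are bounded uniformly in \<open>n\<close>.\<close>

locale bounded_martingale = prob_space M for M :: "'a measure" +
  fixes F :: "nat \<Rightarrow> 'a measure" and f :: "nat \<Rightarrow> 'a \<Rightarrow> real" and L :: real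
  assumes subalgebra: "subalgebra M (F n)"
    and filtration: "sets (F n) \<subseteq> sets (F (Suc n))"
    and adapted: "bounded_measurable (F n) (f n)"
    and orthogonal: "bounded_measurable (F n) X \<Longrightarrow> expectation (\<lambda>\<omega>. (f (Suc n) \<omega> - f n \<omega>) * X \<omega>) = 0"
    and second_moment_le: "expectation (\<lambda>\<omega>. (f n \<omega>)\<^sup>2) \<le> L"
begin

lemma space_F [simp]: "space (F n) = space M"
  using subalgebra by (simp add: subalgebra_def)

lemma filtration_mono: "n \<le> m \<Longrightarrow> sets (F n) \<subseteq> sets (F m)"
  by (rule lift_Suc_mono_le[of "\<lambda>n. sets (F n)"]) (rule filtration)

abbreviation "observed n \<equiv> bounded_measurable (F n)"

lemma observed_mono: "observed n X \<Longrightarrow> n \<le> m \<Longrightarrow> observed m X"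
  by (rule bounded_measurable_mono[of "F n"]) (simp_all add: filtration_mono)

lemma observed_measurable: "observed n X \<Longrightarrow> X \<in> borel_measurable M"
  unfolding bounded_measurable_def by (blast intro: measurable_from_subalg[OF subalgebra])

lemma observed_integrable: "observed n X \<Longrightarrow> integrable M X"
  using subalgebra[of n] bounded_measurable_mono[of "F n" X M]
  by (intro bounded_measurable_integrable) (simp add: subalgebra_def)

lemma observed_f: "n \<le> m \<Longrightarrow> observed m (f n)"
  using adapted by (rule observed_mono)

lemma f_measurable [measurable]: "f n \<in> borel_measurable M"
  by (rule observed_measurable[OF observed_f[OF order_refl]])

lemma increments_orthogonal:
  assumes "observed n X" "n \<le> m"
  shows "expectation (\<lambda>\<omega>. (f m \<omega> - f n \<omega>) * X \<omega>) = 0"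
  using \<open>n \<le> m\<close>
proof (induction rule: dec_induct)
  case base
  show ?case by simp
next
  case (step m)
  have X: "observed j X" if "n \<le> j" for j
    using assms(1) that by (rule observed_mono)
  have "expectation (\<lambda>\<omega>. (f (Suc m) \<omega> - f n \<omega>) * X \<omega>) =
      expectation (\<lambda>\<omega>. (f (Suc m) \<omega> - f m \<omega>) * X \<omega> + (f m \<omega> - f n \<omega>) * X \<omega>)"
    by (simp add: algebra_simps)
  also have "\<dots> = expectation (\<lambda>\<omega>. (f (Suc m) \<omega> - f m \<omega>) * X \<omega>)
      + expectation (\<lambda>\<omega>. (f m \<omega> - f n \<omega>) * X \<omega>)"
    using step by (intro Bochner_Integration.integral_add observed_integrable[of "Suc m"]
        bounded_measurable_mult bounded_measurable_diff observed_f X) auto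
  also have "\<dots> = 0"
    using orthogonal[OF X[OF \<open>n \<le> m\<close>]] step.IH by simp
  finally show ?case .
qed

lemma second_moment_increment:
  assumes "n \<le> m"
  shows "expectation (\<lambda>\<omega>. (f m \<omega> - f n \<omega>)\<^sup>2) =
    expectation (\<lambda>\<omega>. (f m \<omega>)\<^sup>2) - expectation (\<lambda>\<omega>. (f n \<omega>)\<^sup>2)"
proof -
  have "(f m \<omega> - f n \<omega>)\<^sup>2 = (f m \<omega>)\<^sup>2 - (f n \<omega>)\<^sup>2 - 2 * ((f m \<omega> - f n \<omega>) * f n \<omega>)" for \<omega>
    by (simp add: power2_eq_square algebra_simps)
  moreover have "integrable M (\<lambda>\<omega>. (f m \<omega>)\<^sup>2)" "integrable M (\<lambda>\<omega>. (f n \<omega>)\<^sup>2)"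
     "integrable M (\<lambda>\<omega>. (f m \<omega> - f n \<omega>) * f n \<omega>)"
    using assms by (intro observed_integrable[of m] bounded_measurable_square bounded_measurable_mult bounded_measurable_diff observed_f; simp)+
  ultimately show ?thesis
    using increments_orthogonal[OF observed_f[OF order_refl] assms] by simp
qed

lemma second_moment_mono:
  "n \<le> m \<Longrightarrow> expectation (\<lambda>\<omega>. (f n \<omega>)\<^sup>2) \<le> expectation (\<lambda>\<omega>. (f m \<omega>)\<^sup>2)"
  using second_moment_increment[of n m] Bochner_Integration.integral_nonneg[of M "\<lambda>\<omega>. (f m \<omega> - f n \<omega>)\<^sup>2"] by simp

text \<open>The martingale \<open>f (N + n) - f N\<close>, frozen as soon as its modulus reaches \<open>\<epsilon>\<close>. Its final value records
  whether the level was ever reached, while its second moment is no larger than that of the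
  unfrozen martingale: this turns the Chebyshev inequality into a maximal inequality.\<close>

primrec stopped :: "nat \<Rightarrow> real \<Rightarrow> nat \<Rightarrow> 'a \<Rightarrow> real" where
  "stopped N \<epsilon> 0 \<omega> = 0"
| "stopped N \<epsilon> (Suc n) \<omega> = stopped N \<epsilon> n \<omega> +
     indicator {\<omega>. \<forall>j\<le>n. \<bar>f (N + j) \<omega> - f N \<omega>\<bar> < \<epsilon>} \<omega> * (f (N + Suc n) \<omega> - f (N + n) \<omega>)"

lemma stopped_cases:
  "if \<forall>j\<le>n. \<bar>f (N + j) \<omega> - f N \<omega>\<bar> < \<epsilon> then stopped N \<epsilon> n \<omega> = f (N + n) \<omega> - f N \<omega>
   else \<epsilon> \<le> \<bar>stopped N \<epsilon> n \<omega>\<bar>"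
proof (induction n)
  case 0
  show ?case by simp
next
  case (Suc n)
  show ?case
  proof (cases "\<forall>j\<le>n. \<bar>f (N + j) \<omega> - f N \<omega>\<bar> < \<epsilon>")
    case True
    then have "stopped N \<epsilon> (Suc n) \<omega> = f (N + Suc n) \<omega> - f N \<omega>"
      using Suc.IH by simp
    moreover have "(\<forall>j\<le>Suc n. \<bar>f (N + j) \<omega> - f N \<omega>\<bar> < \<epsilon>) \<longleftrightarrow> \<bar>f (N + Suc n) \<omega> - f N \<omega>\<bar> < \<epsilon>"
      using True le_Suc_eq by auto
    ultimately show ?thesis by auto
  next
    case False
    then have "\<not> (\<forall>j\<le>Suc n. \<bar>f (N + j) \<omega> - f N \<omega>\<bar> < \<epsilon>)"
      by (meson le_SucI)
    moreover have "stopped N \<epsilon> (Suc n) \<omega> = stopped N \<epsilon> n \<omega>"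
      using False by (auto simp: indicator_def)
    ultimately show ?thesis
      using Suc.IH False by auto
  qed
qed

lemma observed_before_exit:
  "observed (N + n) (indicator {\<omega>. \<forall>j\<le>n. \<bar>f (N + j) \<omega> - f N \<omega>\<bar> < \<epsilon>})"
proof -
  have [measurable]: "f (N + j) \<in> borel_measurable (F (N + n))" if "j \<le> n" for j
    using observed_f[of "N + j" "N + n"] that by (simp add: bounded_measurable_def)
  have [measurable]: "f N \<in> borel_measurable (F (N + n))"
    using observed_f[of "N" "N + n"] by (simp add: bounded_measurable_def)
  have "Measurable.pred (F (N + n)) (\<lambda>\<omega>. \<forall>j\<in>{..n}. \<bar>f (N + j) \<omega> - f N \<omega>\<bar> < \<epsilon>)"
    by (intro pred_intros_finite) auto
  then have "indicator {\<omega>. \<forall>j\<in>{..n}. \<bar>f (N + j) \<omega> - f N \<omega>\<bar> < \<epsilon>} \<in> borel_measurable (F (N + n))"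
    by measurable
  then show ?thesis
    by (auto simp: bounded_measurable_def intro!: exI[of _ 1] simp: indicator_def)
qed

lemma observed_stopped: "observed (N + n) (stopped N \<epsilon> n)"
proof (induction n)
  case 0
  show ?case by (auto simp: bounded_measurable_def)
next
  case (Suc n)
  have "observed (N + Suc n) (\<lambda>\<omega>. stopped N \<epsilon> n \<omega> +
     indicator {\<omega>. \<forall>j\<le>n. \<bar>f (N + j) \<omega> - f N \<omega>\<bar> < \<epsilon>} \<omega> * (f (N + Suc n) \<omega> - f (N + n) \<omega>))"
    by (intro bounded_measurable_add bounded_measurable_mult bounded_measurable_diff observed_f
        observed_mono[OF Suc.IH] observed_mono[OF observed_before_exit]) auto
  then show ?case by simp
qed

text \<open>Freezing multiplies each increment by an indicator known before the increment, so increments remain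
  orthogonal to the past and their second moments can only shrink.\<close>

lemma stopped_second_moment:
  "expectation (\<lambda>\<omega>. (stopped N \<epsilon> n \<omega>)\<^sup>2) \<le>
     expectation (\<lambda>\<omega>. (f (N + n) \<omega>)\<^sup>2) - expectation (\<lambda>\<omega>. (f N \<omega>)\<^sup>2)"
proof (induction n)
  case 0
  show ?case by simp
next
  case (Suc n)
  define I :: "'a \<Rightarrow> real" where "I = indicator {\<omega>. \<forall>j\<le>n. \<bar>f (N + j) \<omega> - f N \<omega>\<bar> < \<epsilon>}"
  define \<Delta> where "\<Delta> = (\<lambda>\<omega>. f (Suc (N + n)) \<omega> - f (N + n) \<omega>)"
  let ?g = "stopped N \<epsilon> n"
  have I: "(I \<omega>)\<^sup>2 = I \<omega>" "I \<omega> \<le> 1" "0 \<le> I \<omega>" for \<omega>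
    by (auto simp: I_def indicator_def)
  have obs_I: "observed (N + n) I"
    unfolding I_def by (rule observed_before_exit)
  have obs: "observed (Suc (N + n)) ?g" "observed (Suc (N + n)) I" "observed (Suc (N + n)) \<Delta>"
    unfolding \<Delta>_def by (rule observed_mono[OF observed_stopped] observed_mono[OF obs_I]
        bounded_measurable_diff[OF observed_f observed_f]; simp)+
  have ints: "integrable M (\<lambda>\<omega>. (?g \<omega>)\<^sup>2)" "integrable M (\<lambda>\<omega>. \<Delta> \<omega> * (I \<omega> * ?g \<omega>))"
      "integrable M (\<lambda>\<omega>. I \<omega> * (\<Delta> \<omega>)\<^sup>2)" "integrable M (\<lambda>\<omega>. (\<Delta> \<omega>)\<^sup>2)"
    by (rule observed_integrable[of "Suc (N + n)"], intro bounded_measurable_square bounded_measurable_mult obs)+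
  have "(stopped N \<epsilon> (Suc n) \<omega>)\<^sup>2 = (?g \<omega>)\<^sup>2 + 2 * (\<Delta> \<omega> * (I \<omega> * ?g \<omega>)) + I \<omega> * (\<Delta> \<omega>)\<^sup>2" for \<omega>
  proof -
    have "stopped N \<epsilon> (Suc n) \<omega> = ?g \<omega> + I \<omega> * \<Delta> \<omega>"
      by (simp add: I_def \<Delta>_def)
    then show ?thesis
      using I(1)[of \<omega>] by (simp add: power2_sum power_mult_distrib algebra_simps)
  qed
  then have "expectation (\<lambda>\<omega>. (stopped N \<epsilon> (Suc n) \<omega>)\<^sup>2) = expectation (\<lambda>\<omega>. (?g \<omega>)\<^sup>2)
      + 2 * expectation (\<lambda>\<omega>. \<Delta> \<omega> * (I \<omega> * ?g \<omega>)) + expectation (\<lambda>\<omega>. I \<omega> * (\<Delta> \<omega>)\<^sup>2)"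
    using ints by simp
  also have "expectation (\<lambda>\<omega>. \<Delta> \<omega> * (I \<omega> * ?g \<omega>)) = 0"
    unfolding \<Delta>_def by (intro increments_orthogonal bounded_measurable_mult obs_I observed_stopped) simp
  also have "expectation (\<lambda>\<omega>. I \<omega> * (\<Delta> \<omega>)\<^sup>2) \<le> expectation (\<lambda>\<omega>. (\<Delta> \<omega>)\<^sup>2)"
    using I by (intro integral_mono ints mult_left_le_one_le) auto
  finally show ?case
    using Suc.IH second_moment_increment[of "N + n" "Suc (N + n)"] by (simp add: \<Delta>_def)
qed

text \<open>This is Kolmogorov's maximal inequality for the increments after time \<open>N\<close>.\<close>

lemma maximal_inequality:
  assumes "0 < \<epsilon>"
  shows "prob {\<omega>\<in>space M. \<exists>j\<le>n. \<epsilon> \<le> \<bar>f (N + j) \<omega> - f N \<omega>\<bar>} \<le>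
    (expectation (\<lambda>\<omega>. (f (N + n) \<omega>)\<^sup>2) - expectation (\<lambda>\<omega>. (f N \<omega>)\<^sup>2)) / \<epsilon>\<^sup>2"
proof -
  have [measurable]: "stopped N \<epsilon> n \<in> borel_measurable M"
    by (rule observed_measurable[OF observed_stopped])
  have "prob {\<omega>\<in>space M. \<exists>j\<le>n. \<epsilon> \<le> \<bar>f (N + j) \<omega> - f N \<omega>\<bar>} \<le>
      prob {\<omega>\<in>space M. \<epsilon> \<le> \<bar>stopped N \<epsilon> n \<omega>\<bar>}"
  proof (intro finite_measure_mono subsetI)
    fix \<omega> assume "\<omega> \<in> {\<omega>\<in>space M. \<exists>j\<le>n. \<epsilon> \<le> \<bar>f (N + j) \<omega> - f N \<omega>\<bar>}"
    then have "\<omega> \<in> space M" "\<not> (\<forall>j\<le>n. \<bar>f (N + j) \<omega> - f N \<omega>\<bar> < \<epsilon>)"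
      by force+
    then show "\<omega> \<in> {\<omega>\<in>space M. \<epsilon> \<le> \<bar>stopped N \<epsilon> n \<omega>\<bar>}"
      using stopped_cases[of n N \<omega> \<epsilon>] by auto
  qed simp
  also have "\<dots> \<le> expectation (\<lambda>\<omega>. (stopped N \<epsilon> n \<omega>)\<^sup>2) / \<epsilon>\<^sup>2"
    using assms
    by (intro second_moment_method observed_integrable[OF bounded_measurable_square, OF observed_stopped]) simp_all
  also have "\<dots> \<le> (expectation (\<lambda>\<omega>. (f (N + n) \<omega>)\<^sup>2) - expectation (\<lambda>\<omega>. (f N \<omega>)\<^sup>2)) / \<epsilon>\<^sup>2"
    by (intro divide_right_mono stopped_second_moment) simp
  finally show ?thesis .
qed

definition limit_second_moment :: real where
  "limit_second_moment = lim (\<lambda>n. expectation (\<lambda>\<omega>. (f n \<omega>)\<^sup>2))"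

lemma second_moment_tendsto:
  "(\<lambda>n. expectation (\<lambda>\<omega>. (f n \<omega>)\<^sup>2)) \<longlonglongrightarrow> limit_second_moment"
proof -
  have "convergent (\<lambda>n. expectation (\<lambda>\<omega>. (f n \<omega>)\<^sup>2))"
    by (rule Bseq_mono_convergent)
      (auto intro!: BseqI'[where K = L] second_moment_mono simp: second_moment_le)
  then show ?thesis
    by (simp add: limit_second_moment_def convergent_LIMSEQ_iff)
qed

lemma second_moment_le_limit: "expectation (\<lambda>\<omega>. (f n \<omega>)\<^sup>2) \<le> limit_second_moment"
  using second_moment_mono by (intro incseq_le[OF _ second_moment_tendsto]) (auto simp: incseq_def)

lemma prob_oscillation_le:
  assumes "0 < \<epsilon>"
  shows "prob {\<omega>\<in>space M. \<exists>j. \<epsilon> \<le> \<bar>f (N + j) \<omega> - f N \<omega>\<bar>} \<le>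
    (limit_second_moment - expectation (\<lambda>\<omega>. (f N \<omega>)\<^sup>2)) / \<epsilon>\<^sup>2"
proof -
  define A where "A n = {\<omega>\<in>space M. \<exists>j\<le>n. \<epsilon> \<le> \<bar>f (N + j) \<omega> - f N \<omega>\<bar>}" for n
  have "(\<lambda>n. prob (A n)) \<longlonglongrightarrow> prob (\<Union>n. A n)"
  proof (rule finite_Lim_measure_incseq)
    show "range A \<subseteq> events" unfolding A_def by auto
    show "incseq A" unfolding A_def incseq_def using order_trans by blast
  qed
  moreover have "prob (A n) \<le> (limit_second_moment - expectation (\<lambda>\<omega>. (f N \<omega>)\<^sup>2)) / \<epsilon>\<^sup>2" for n
    unfolding A_def using second_moment_le_limit
    by (intro order_trans[OF maximal_inequality[OF assms]] divide_right_mono diff_right_mono) auto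
  ultimately have "prob (\<Union>n. A n) \<le> (limit_second_moment - expectation (\<lambda>\<omega>. (f N \<omega>)\<^sup>2)) / \<epsilon>\<^sup>2"
    by (intro LIMSEQ_le_const2) auto
  also have "(\<Union>n. A n) = {\<omega>\<in>space M. \<exists>j. \<epsilon> \<le> \<bar>f (N + j) \<omega> - f N \<omega>\<bar>}"
    by (auto simp: A_def)
  finally show ?thesis .
qed

text \<open>The maximal inequality bounds the probability of an \<open>\<epsilon>\<close>-oscillation after \<open>N\<close> by the part of the
  second moment still to come, which tends to 0 with \<open>N\<close>.\<close>

lemma AE_small_oscillation:
  assumes "0 < \<epsilon>"
  shows "AE \<omega> in M. \<exists>N. \<forall>j. \<bar>f (N + j) \<omega> - f N \<omega>\<bar> < \<epsilon>"
proof -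
  define B where "B = {\<omega>\<in>space M. \<forall>N. \<exists>j. \<epsilon> \<le> \<bar>f (N + j) \<omega> - f N \<omega>\<bar>}"
  have [measurable]: "B \<in> events"
    unfolding B_def by measurable
  have "(\<lambda>N. (limit_second_moment - expectation (\<lambda>\<omega>. (f N \<omega>)\<^sup>2)) / \<epsilon>\<^sup>2)
      \<longlonglongrightarrow> (limit_second_moment - limit_second_moment) / \<epsilon>\<^sup>2"
    using assms by (intro tendsto_intros second_moment_tendsto) simp
  moreover have "prob B \<le> (limit_second_moment - expectation (\<lambda>\<omega>. (f N \<omega>)\<^sup>2)) / \<epsilon>\<^sup>2" for N
    unfolding B_def by (intro order_trans[OF finite_measure_mono prob_oscillation_le[OF assms]]) auto
  ultimately have "prob B \<le> (limit_second_moment - limit_second_moment) / \<epsilon>\<^sup>2"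
    by (intro LIMSEQ_le_const) auto
  then have "prob B = 0"
    by (simp add: measure_le_0_iff)
  then have "AE \<omega> in M. \<omega> \<notin> B"
    by (simp add: prob_eq_0)
  then show ?thesis
    by (rule AE_mp) (auto simp: B_def not_le intro!: AE_I2)
qed

lemma AE_convergent: "AE \<omega> in M. convergent (\<lambda>n. f n \<omega>)"
proof -
  have "AE \<omega> in M. \<forall>i::nat. \<exists>N. \<forall>j. \<bar>f (N + j) \<omega> - f N \<omega>\<bar> < inverse (real (Suc i))"
    unfolding AE_all_countable by (intro allI AE_small_oscillation) simp
  then show ?thesis
  proof eventually_elim
    case (elim \<omega>)
    have "Cauchy (\<lambda>n. f n \<omega>)"
    proof (rule CauchyI)
      fix e :: real assume "0 < e"
      then obtain i where i: "inverse (real (Suc i)) < e / 2"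
        using reals_Archimedean[of "e / 2"] by auto
      obtain N where N: "\<And>j. \<bar>f (N + j) \<omega> - f N \<omega>\<bar> < inverse (real (Suc i))"
        using elim by blast
      have "norm (f m \<omega> - f n \<omega>) < e" if "N \<le> m" "N \<le> n" for m n
        using N[of "m - N"] N[of "n - N"] that i by simp
      then show "\<exists>N. \<forall>m\<ge>N. \<forall>n\<ge>N. norm (f m \<omega> - f n \<omega>) < e"
        by blast
    qed
    then show ?case
      by (rule Cauchy_convergent)
  qed
qed

text \<open>By the Fatou lemma, the squared distance of \<open>f n\<close> to the limit is at most the limit inferior of the
  squared distances to \<open>f m\<close>, and these are differences of second moments.\<close>

lemma L2_limit:
  assumes [measurable]: "f' \<in> borel_measurable M" and lim: "AE \<omega> in M. (\<lambda>n. f n \<omega>) \<longlonglongrightarrow> f' \<omega>"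
  shows "integrable M (\<lambda>\<omega>. (f n \<omega> - f' \<omega>)\<^sup>2)"
    and "(\<lambda>n. expectation (\<lambda>\<omega>. (f n \<omega> - f' \<omega>)\<^sup>2)) \<longlonglongrightarrow> 0"
    and "integrable M (\<lambda>\<omega>. (f' \<omega>)\<^sup>2)"
proof -
  let ?r = "\<lambda>n. limit_second_moment - expectation (\<lambda>\<omega>. (f n \<omega>)\<^sup>2)"
  have nn: "(\<integral>\<^sup>+\<omega>. ennreal ((f n \<omega> - f' \<omega>)\<^sup>2) \<partial>M) \<le> ennreal (?r n)" for n
  proof -
    have "(\<integral>\<^sup>+\<omega>. ennreal ((f n \<omega> - f' \<omega>)\<^sup>2) \<partial>M) =
        (\<integral>\<^sup>+\<omega>. liminf (\<lambda>m. ennreal ((f n \<omega> - f m \<omega>)\<^sup>2)) \<partial>M)"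
    proof (rule nn_integral_cong_AE, use lim in eventually_elim)
      case (elim \<omega>)
      have "(\<lambda>m. ennreal ((f n \<omega> - f m \<omega>)\<^sup>2)) \<longlonglongrightarrow> ennreal ((f n \<omega> - f' \<omega>)\<^sup>2)"
        by (intro tendsto_intros tendsto_ennrealI elim)
      then show ?case
        by (rule lim_imp_Liminf[OF trivial_limit_sequentially, symmetric])
    qed
    also have "\<dots> \<le> liminf (\<lambda>m. \<integral>\<^sup>+\<omega>. ennreal ((f n \<omega> - f m \<omega>)\<^sup>2) \<partial>M)"
      by (rule nn_integral_liminf) measurable
    also have "\<dots> \<le> liminf (\<lambda>m. ennreal (?r n))"
    proof (rule Liminf_mono, rule eventually_sequentiallyI)
      fix m assume "n \<le> m"
      have "integrable M (\<lambda>\<omega>. (f n \<omega> - f m \<omega>)\<^sup>2)"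
        using \<open>n \<le> m\<close> by (intro observed_integrable[of m] bounded_measurable_square bounded_measurable_diff observed_f) auto
      then have "(\<integral>\<^sup>+\<omega>. ennreal ((f n \<omega> - f m \<omega>)\<^sup>2) \<partial>M) = ennreal (expectation (\<lambda>\<omega>. (f n \<omega> - f m \<omega>)\<^sup>2))"
        by (intro nn_integral_eq_integral) auto
      also have "\<dots> = ennreal (expectation (\<lambda>\<omega>. (f m \<omega> - f n \<omega>)\<^sup>2))"
        by (simp add: power2_commute)
      also have "\<dots> \<le> ennreal (?r n)"
        using second_moment_increment[OF \<open>n \<le> m\<close>] second_moment_le_limit[of m] by (intro ennreal_leI) simp
      finally show "(\<integral>\<^sup>+\<omega>. ennreal ((f n \<omega> - f m \<omega>)\<^sup>2) \<partial>M) \<le> ennreal (?r n)" .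
    qed
    also have "\<dots> = ennreal (?r n)"
      by (simp add: Liminf_const)
    finally show ?thesis .
  qed
  have int: "integrable M (\<lambda>\<omega>. (f n \<omega> - f' \<omega>)\<^sup>2)" for n
    using nn[of n] by (intro integrableI_nonneg) (auto simp: le_less_trans)
  then show "integrable M (\<lambda>\<omega>. (f n \<omega> - f' \<omega>)\<^sup>2)" .
  have le: "expectation (\<lambda>\<omega>. (f n \<omega> - f' \<omega>)\<^sup>2) \<le> ?r n" for n
    using nn[of n] nn_integral_eq_integral[OF int[of n]] second_moment_le_limit[of n]
    by (simp add: ennreal_le_iff)
  show "(\<lambda>n. expectation (\<lambda>\<omega>. (f n \<omega> - f' \<omega>)\<^sup>2)) \<longlonglongrightarrow> 0"
  proof (rule tendsto_sandwich)
    show "\<forall>\<^sub>F n in sequentially. 0 \<le> expectation (\<lambda>\<omega>. (f n \<omega> - f' \<omega>)\<^sup>2)"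
      by simp
    show "\<forall>\<^sub>F n in sequentially. expectation (\<lambda>\<omega>. (f n \<omega> - f' \<omega>)\<^sup>2) \<le> ?r n"
      by (intro always_eventually allI le)
    show "(\<lambda>_. 0) \<longlonglongrightarrow> (0 :: real)"
      by simp
    have "?r \<longlonglongrightarrow> limit_second_moment - limit_second_moment"
      by (intro tendsto_intros second_moment_tendsto)
    then show "?r \<longlonglongrightarrow> 0"
      by simp
  qed
  have "integrable M (\<lambda>\<omega>. (f 0 \<omega> + - (f 0 \<omega> - f' \<omega>))\<^sup>2)"
  proof (rule square_integrable_add)
    show "integrable M (\<lambda>\<omega>. (f 0 \<omega>)\<^sup>2)"
      by (intro observed_integrable[of 0] bounded_measurable_square observed_f) simp
    show "integrable M (\<lambda>\<omega>. (- (f 0 \<omega> - f' \<omega>))\<^sup>2)"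
      using int[of 0] by (simp only: power2_minus)
  qed measurable
  then show "integrable M (\<lambda>\<omega>. (f' \<omega>)\<^sup>2)"
    by simp
qed

end

section \<open>The mass process in a two-jump environment\<close>

text \<open>One time step of the mass profile \<open>g\<close>: the mass at a site moves by \<open>x + 1\<close> with the probability \<open>b\<close> of
  that site and by \<open>x\<close> otherwise.\<close>

definition push :: "int \<Rightarrow> (int \<times> int \<Rightarrow> real) \<Rightarrow> int \<Rightarrow> (int \<Rightarrow> real) \<Rightarrow> int \<Rightarrow> real" where
  "push x b t g y = g (y - x) * (1 - b (y - x, t)) + g (y - x - 1) * b (y - x - 1, t)"

primrec evolve :: "int \<Rightarrow> (int \<times> int \<Rightarrow> real) \<Rightarrow> int \<Rightarrow> nat \<Rightarrow> (int \<Rightarrow> real) \<Rightarrow> int \<Rightarrow> real" where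
  "evolve x b s 0 g = g"
| "evolve x b s (Suc n) g = push x b (s + int n) (evolve x b s n g)"

text \<open>The recursion peels off the last time step, which gives the recursion for the second moments. The
  martingale property compares two starting times and needs the first step peeled off instead.\<close>

lemma evolve_Suc_first: "evolve x b s (Suc n) g = evolve x b (s + 1) n (push x b s g)"
proof (induction n)
  case (Suc n)
  have "s + int (Suc n) = s + 1 + int n"
    by simp
  with Suc show ?case
    by (metis evolve.simps(2))
qed simp

lemma evolve_diff:
  "evolve x b s n (\<lambda>z. g z - g' z) y = evolve x b s n g y - evolve x b s n g' y"
proof (induction n arbitrary: y)
  case (Suc n)
  show ?case
    unfolding evolve.simps push_def Suc.IH by (simp add: algebra_simps)
qed simp

locale iid_jump_field = prob_space M for M :: "'a measure" +
  fixes a :: "int \<times> int \<Rightarrow> 'a \<Rightarrow> real" and q v :: real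
  assumes indep: "indep_vars (\<lambda>_. borel) a UNIV"
    and nonneg: "\<omega> \<in> space M \<Longrightarrow> 0 \<le> a i \<omega>"
    and le_one: "\<omega> \<in> space M \<Longrightarrow> a i \<omega> \<le> 1"
    and mean: "expectation (a i) = q"
    and second_moment: "expectation (\<lambda>\<omega>. (a i \<omega>)\<^sup>2) = v"
    and nondegenerate: "v < q"
begin

definition sites :: "(int \<times> int) set \<Rightarrow> 'a measure" where
  "sites I = sigma (space M) (\<Union>i\<in>I. {a i -` A \<inter> space M |A. A \<in> sets borel})"

lemma space_sites [simp]: "space (sites I) = space M"
  by (simp add: sites_def space_measure_of_conv)

lemma sets_sites:
  "sets (sites I) = sigma_sets (space M) (\<Union>i\<in>I. {a i -` A \<inter> space M |A. A \<in> sets borel})"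
  unfolding sites_def by (rule sets_measure_of) auto

lemma sites_mono: "I \<subseteq> J \<Longrightarrow> sets (sites I) \<subseteq> sets (sites J)"
  unfolding sets_sites by (intro sigma_sets_mono') auto

lemma a_measurable [measurable]: "a i \<in> borel_measurable M"
  using indep unfolding indep_vars_def2 by blast

lemma subalgebra_sites: "subalgebra M (sites I)"
  unfolding subalgebra_def sets_sites by (auto intro!: sets.sigma_sets_subset)

abbreviation "seen I \<equiv> bounded_measurable (sites I)"

lemma seen_mono: "seen I X \<Longrightarrow> I \<subseteq> J \<Longrightarrow> seen J X"
  by (rule bounded_measurable_mono[of "sites I"]) (simp_all add: sites_mono)

lemma seen_bounded_measurable: "seen I X \<Longrightarrow> bounded_measurable M X"
  using subalgebra_sites[of I] bounded_measurable_mono[of "sites I" X M] by (simp add: subalgebra_def)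

lemmas seen_integrable = bounded_measurable_integrable[OF seen_bounded_measurable]

lemma seen_a: "i \<in> I \<Longrightarrow> seen I (a i)"
proof -
  assume "i \<in> I"
  then have "a i -` A \<inter> space M \<in> sets (sites I)" if "A \<in> sets borel" for A
    unfolding sets_sites using that by (intro sigma_sets.Basic) blast
  then have "a i \<in> borel_measurable (sites I)"
    by (intro measurableI) simp_all
  moreover have "\<forall>\<omega>\<in>space (sites I). \<bar>a i \<omega>\<bar> \<le> 1"
    using nonneg le_one by simp
  ultimately show ?thesis
    unfolding bounded_measurable_def by blast
qed

text \<open>Grouping an independent family into two disjoint blocks gives independent sigma-algebras.\<close>

lemma expectation_mult_disjoint:
  assumes X: "seen I X" and Y: "seen J Y" and "I \<inter> J = {}"
  shows "expectation (\<lambda>\<omega>. X \<omega> * Y \<omega>) = expectation X * expectation Y"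
proof -
  have all: "indep_sets (\<lambda>i. {a i -` A \<inter> space M |A. A \<in> sets borel}) UNIV"
    using indep unfolding indep_vars_def2 by blast
  have "indep_sets (\<lambda>b. sigma_sets (space M)
      (\<Union>i\<in>case_bool I J b. {a i -` A \<inter> space M |A. A \<in> sets borel})) UNIV"
  proof (rule indep_sets_collect_sigma)
    show "indep_sets (\<lambda>i. {a i -` A \<inter> space M |A. A \<in> sets borel}) (\<Union>b\<in>UNIV. case_bool I J b)"
      by (rule indep_sets_mono_index[OF _ all]) simp
    show "disjoint_family_on (case_bool I J) UNIV"
      using \<open>I \<inter> J = {}\<close> by (auto simp: disjoint_family_on_def split: bool.splits)
    show "Int_stable {a i -` A \<inter> space M |A. A \<in> sets borel}" for i
    proof (rule Int_stableI)
      fix S T assume "S \<in> {a i -` A \<inter> space M |A. A \<in> sets borel}" "T \<in> {a i -` A \<inter> space M |A. A \<in> sets borel}"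
      then obtain A B where "S = a i -` A \<inter> space M" "T = a i -` B \<inter> space M" "A \<in> sets borel" "B \<in> sets borel"
        by blast
      then show "S \<inter> T \<in> {a i -` A \<inter> space M |A. A \<in> sets borel}"
        by (auto intro!: exI[of _ "A \<inter> B"])
    qed
  qed
  then have sep: "indep_sets (\<lambda>b. sets (sites (case_bool I J b))) UNIV"
    by (simp add: sets_sites)
  have gen: "sigma_sets (space M) {Z -` A \<inter> space M |A. A \<in> sets borel} \<subseteq> sets (sites K)"
    if "seen K Z" for K Z
  proof -
    have Z: "Z \<in> borel_measurable (sites K)"
      using that unfolding bounded_measurable_def by blast
    have "{Z -` A \<inter> space M |A. A \<in> sets borel} \<subseteq> sets (sites K)"
      using measurable_sets[OF Z] unfolding space_sites by blast
    then show ?thesis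
      by (rule sets.sigma_sets_subset[of _ "sites K", unfolded space_sites])
  qed
  have "indep_set (sigma_sets (space M) {X -` A \<inter> space M |A. A \<in> sets borel})
      (sigma_sets (space M) {Y -` A \<inter> space M |A. A \<in> sets borel})"
    unfolding indep_set_def using gen[OF X] gen[OF Y]
    by (intro indep_sets_mono_sets[OF sep]) (auto split: bool.splits)
  then have "indep_var borel X borel Y"
    unfolding indep_var_eq using seen_bounded_measurable[OF X] seen_bounded_measurable[OF Y]
    unfolding bounded_measurable_def by blast
  then show ?thesis
    by (intro indep_var_lebesgue_integral seen_integrable[OF X] seen_integrable[OF Y])
qed

lemma seen_evolve:
  assumes g: "\<And>z. seen I (g z)" and "I \<subseteq> J" "\<And>y t. s \<le> t \<Longrightarrow> t < s + int n \<Longrightarrow> (y, t) \<in> J"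
  shows "seen J (\<lambda>\<omega>. evolve x (\<lambda>i. a i \<omega>) s n (\<lambda>z. g z \<omega>) y)"
  using assms(3)
proof (induction n arbitrary: y)
  case 0
  show ?case
    using seen_mono[OF g \<open>I \<subseteq> J\<close>] by simp
next
  case (Suc n)
  have IH: "seen J (\<lambda>\<omega>. evolve x (\<lambda>i. a i \<omega>) s n (\<lambda>z. g z \<omega>) y)" for y
    by (rule Suc.IH) (rule Suc.prems, auto)
  have "(y', s + int n) \<in> J" for y'
    by (rule Suc.prems) auto
  then show ?case
    by (simp add: push_def) (intro bounded_measurable_intros IH seen_a)
qed

text \<open>A centred profile known before time \<open>s\<close> stays uncorrelated with the environment from \<open>s\<close> on: the
  evolution only multiplies it by factors from that environment, and these can be absorbed into \<open>X\<close>.\<close>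

lemma expectation_evolve_centred:
  assumes g: "\<And>z. seen {i. snd i < s} (g z)" and centred: "\<And>z. expectation (g z) = 0"
    and X: "seen {i. s \<le> snd i} X"
  shows "expectation (\<lambda>\<omega>. evolve x (\<lambda>i. a i \<omega>) s n (\<lambda>z. g z \<omega>) y * X \<omega>) = 0"
  using X
proof (induction n arbitrary: X y)
  case 0
  have "expectation (\<lambda>\<omega>. g y \<omega> * X \<omega>) = expectation (g y) * expectation X"
    using g 0 by (rule expectation_mult_disjoint) auto
  then show ?case
    by (simp add: centred)
next
  case (Suc n)
  define e where "e z \<omega> = evolve x (\<lambda>i. a i \<omega>) s n (\<lambda>z. g z \<omega>) z" for z \<omega>
  have e: "seen UNIV (e z)" for z
    unfolding e_def by (rule seen_evolve[OF g]) auto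
  let ?l = "(y - x, s + int n)" and ?r = "(y - x - 1, s + int n)"
  have fut: "seen {i. s \<le> snd i} (\<lambda>\<omega>. (1 - a ?l \<omega>) * X \<omega>)" "seen {i. s \<le> snd i} (\<lambda>\<omega>. a ?r \<omega> * X \<omega>)"
    by (intro bounded_measurable_intros seen_a Suc.prems; simp)+
  have "expectation (\<lambda>\<omega>. evolve x (\<lambda>i. a i \<omega>) s (Suc n) (\<lambda>z. g z \<omega>) y * X \<omega>) =
      expectation (\<lambda>\<omega>. e (y - x) \<omega> * ((1 - a ?l \<omega>) * X \<omega>) + e (y - x - 1) \<omega> * (a ?r \<omega> * X \<omega>))"
    by (simp add: push_def e_def algebra_simps)
  also have "\<dots> = expectation (\<lambda>\<omega>. e (y - x) \<omega> * ((1 - a ?l \<omega>) * X \<omega>))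
      + expectation (\<lambda>\<omega>. e (y - x - 1) \<omega> * (a ?r \<omega> * X \<omega>))"
    by (intro Bochner_Integration.integral_add seen_integrable[of UNIV] bounded_measurable_mult e
        seen_mono[OF fut(1)] seen_mono[OF fut(2)]; simp)
  also have "\<dots> = 0"
    using Suc.IH[OF fut(1)] Suc.IH[OF fut(2)] by (simp add: e_def)
  finally show ?case .
qed

lemma expectation_a_mult: "expectation (\<lambda>\<omega>. a i \<omega> * a j \<omega>) = (if i = j then v else q\<^sup>2)"
proof (cases "i = j")
  case True
  then show ?thesis
    using second_moment[of i] by (simp add: power2_eq_square)
next
  case False
  have "expectation (\<lambda>\<omega>. a i \<omega> * a j \<omega>) = expectation (a i) * expectation (a j)"
    by (rule expectation_mult_disjoint[of "{i}" _ "{j}"]) (use False in \<open>auto intro: seen_a\<close>)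
  with False show ?thesis
    by (simp add: mean power2_eq_square)
qed

lemma integrable_a: "integrable M (a i)" "integrable M (\<lambda>\<omega>. a i \<omega> * a j \<omega>)"
  by (intro seen_integrable[of UNIV] bounded_measurable_mult seen_a; simp)+

text \<open>The middle inequality is the non-negativity of the variance of \<open>a i\<close>.\<close>

lemma rates: "0 < q - v" "q - v \<le> q * (1 - q)" "q * (1 - q) \<le> 1 / 2"
proof -
  show "0 < q - v"
    using nondegenerate by simp
  have "(a i \<omega> - q)\<^sup>2 = a i \<omega> * a i \<omega> - 2 * q * a i \<omega> + q\<^sup>2" for i \<omega>
    by (simp add: power2_eq_square algebra_simps)
  then have "expectation (\<lambda>\<omega>. (a (0, 0) \<omega> - q)\<^sup>2) = v - q\<^sup>2"
    using integrable_a by (simp add: expectation_a_mult mean prob_space power2_eq_square)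
  moreover have "0 \<le> expectation (\<lambda>\<omega>. (a (0, 0) \<omega> - q)\<^sup>2)"
    by simp
  ultimately show "q - v \<le> q * (1 - q)"
    by (simp add: algebra_simps power2_eq_square)
  have "0 \<le> (q - 1 / 2)\<^sup>2"
    by simp
  then show "q * (1 - q) \<le> 1 / 2"
    by (simp add: power2_eq_square algebra_simps)
qed

context
  fixes x :: int
begin

text \<open>Unit mass on every site at time \<open>s\<close>, observed after \<open>n\<close> steps.\<close>

definition mass :: "int \<Rightarrow> nat \<Rightarrow> int \<Rightarrow> 'a \<Rightarrow> real" where
  "mass s n y \<omega> = evolve x (\<lambda>i. a i \<omega>) s n (\<lambda>_. 1) y"

lemma mass_Suc:
  "mass s (Suc n) y \<omega> = mass s n (y - x) \<omega> * (1 - a (y - x, s + int n) \<omega>)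
     + mass s n (y - x - 1) \<omega> * a (y - x - 1, s + int n) \<omega>"
  by (simp add: mass_def push_def)

lemma seen_mass:
  "(\<And>y t. s \<le> t \<Longrightarrow> t < s + int n \<Longrightarrow> (y, t) \<in> J) \<Longrightarrow> seen J (mass s n y)"
  unfolding mass_def
  \<comment> \<open>The constant initial profile is known without looking at any site.\<close>
  using seen_evolve[of "{}" "\<lambda>_ _. 1" J s n x y, OF bounded_measurable_const] by auto

text \<open>In the product of two masses each factor splits into two contributions from the previous time. The
  masses there depend on earlier layers than the jump probabilities, so expectations factorise, and
  the four products of jump probabilities have means determined by the distance of the two sites.\<close>

lemma pair_correlation:
  "expectation (\<lambda>\<omega>. mass s n y \<omega> * mass s n y' \<omega>) =
     pair_corr (jump_rate (q - v) (q * (1 - q))) n (y' - y)"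
proof (induction n arbitrary: y y')
  case 0
  show ?case by (simp add: mass_def prob_space)
next
  case (Suc n)
  let ?k = "jump_rate (q - v) (q * (1 - q))"
  let ?c = "pair_corr ?k n"
  let ?H = "\<lambda>z z' \<omega>. mass s n z \<omega> * mass s n z' \<omega>"
  let ?a = "\<lambda>z. a (z, s + int n)"
  let ?past = "{i. snd i < s + int n}" and ?now = "{i. snd i = s + int n}"
  define u u' where "u = y - x" and "u' = y' - x"
  have split: "expectation (\<lambda>\<omega>. ?H z z' \<omega> * W \<omega>) = ?c (z' - z) * expectation W"
    and int: "integrable M (\<lambda>\<omega>. ?H z z' \<omega> * W \<omega>)" if "seen ?now W" for z z' W
  proof -
    have H: "seen ?past (?H z z')"
      by (intro bounded_measurable_mult seen_mass) auto
    then have "expectation (\<lambda>\<omega>. ?H z z' \<omega> * W \<omega>) = expectation (?H z z') * expectation W"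
      using that by (rule expectation_mult_disjoint) auto
    then show "expectation (\<lambda>\<omega>. ?H z z' \<omega> * W \<omega>) = ?c (z' - z) * expectation W"
      by (simp add: Suc.IH)
    show "integrable M (\<lambda>\<omega>. ?H z z' \<omega> * W \<omega>)"
      by (intro seen_integrable[of UNIV] bounded_measurable_mult seen_mono[OF that] seen_mass) auto
  qed
  have W: "seen ?now (\<lambda>\<omega>. (1 - ?a z \<omega>) * (1 - ?a z' \<omega>))" "seen ?now (\<lambda>\<omega>. (1 - ?a z \<omega>) * ?a z' \<omega>)"
      "seen ?now (\<lambda>\<omega>. ?a z \<omega> * (1 - ?a z' \<omega>))" "seen ?now (\<lambda>\<omega>. ?a z \<omega> * ?a z' \<omega>)" for z z'
    by (intro bounded_measurable_intros seen_a; simp)+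
  have k: "?k m = (if m = 0 then q - v else q - q\<^sup>2)" for m
    by (simp add: jump_rate_def algebra_simps power2_eq_square)
  have E: "expectation (\<lambda>\<omega>. (1 - ?a z \<omega>) * (1 - ?a z' \<omega>)) = 1 - q - ?k (z' - z)"
      "expectation (\<lambda>\<omega>. (1 - ?a z \<omega>) * ?a z' \<omega>) = ?k (z' - z)"
      "expectation (\<lambda>\<omega>. ?a z \<omega> * (1 - ?a z' \<omega>)) = ?k (z' - z)"
      "expectation (\<lambda>\<omega>. ?a z \<omega> * ?a z' \<omega>) = q - ?k (z' - z)" for z z'
    using integrable_a unfolding k by (auto simp: algebra_simps mean expectation_a_mult prob_space)
  have "mass s (Suc n) y \<omega> * mass s (Suc n) y' \<omega> =
      ?H u u' \<omega> * ((1 - ?a u \<omega>) * (1 - ?a u' \<omega>)) + ?H u (u' - 1) \<omega> * ((1 - ?a u \<omega>) * ?a (u' - 1) \<omega>)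
      + ?H (u - 1) u' \<omega> * (?a (u - 1) \<omega> * (1 - ?a u' \<omega>))
      + ?H (u - 1) (u' - 1) \<omega> * (?a (u - 1) \<omega> * ?a (u' - 1) \<omega>)" for \<omega>
    unfolding mass_Suc u_def u'_def by (simp add: algebra_simps)
  then have "expectation (\<lambda>\<omega>. mass s (Suc n) y \<omega> * mass s (Suc n) y' \<omega>) =
      ?c (u' - u) * (1 - q - ?k (u' - u)) + ?c (u' - 1 - u) * ?k (u' - 1 - u)
      + ?c (u' - (u - 1)) * ?k (u' - (u - 1)) + ?c (u' - u) * (q - ?k (u' - u))"
    by (simp add: int W split E)
  also have "\<dots> = pair_corr ?k (Suc n) (y' - y)"
  proof -
    define d where "d = y' - y"
    have shifts: "u' - u = d" "u' - 1 - u = d - 1" "u' - (u - 1) = d + 1"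
      by (auto simp: u_def u'_def d_def)
    show ?thesis
      unfolding shifts d_def[symmetric] pair_corr.simps by (simp add: algebra_simps)
  qed
  finally show ?case .
qed

text \<open>Starting one step earlier replaces the initial profile 1 by one with mean 1 that depends on the
  additional layer only, so the increment is the evolution of a centred profile. The uniform bound on
  the second moments is the stationary value of the correlation recursion at the origin.\<close>

lemma mass_martingale:
  "bounded_martingale M (\<lambda>n. sites {i. - int n \<le> snd i}) (\<lambda>n. mass (- int n) n y)
     (q * (1 - q) / (q - v))"
proof unfold_locales
  fix n :: nat
  show "subalgebra M (sites {i. - int n \<le> snd i})"
    by (rule subalgebra_sites)
  show "sets (sites {i. - int n \<le> snd i}) \<subseteq> sets (sites {i. - int (Suc n) \<le> snd i})"
    by (rule sites_mono) auto
  show "seen {i. - int n \<le> snd i} (mass (- int n) n y)"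
    by (rule seen_mass) auto
  show "expectation (\<lambda>\<omega>. (mass (- int n) n y \<omega>)\<^sup>2) \<le> q * (1 - q) / (q - v)"
    using pair_corr_0_le[OF rates] pair_correlation[of "- int n" n y y] by (simp add: power2_eq_square)
  fix X assume X: "seen {i. - int n \<le> snd i} X"
  define g where "g z \<omega> = push x (\<lambda>i. a i \<omega>) (- int n - 1) (\<lambda>_. 1) z - 1" for z \<omega>
  have g: "g z \<omega> = a (z - x - 1, - int n - 1) \<omega> - a (z - x, - int n - 1) \<omega>" for z \<omega>
    by (simp add: g_def push_def)
  have "mass (- int (Suc n)) (Suc n) y \<omega> - mass (- int n) n y \<omega> =
      evolve x (\<lambda>i. a i \<omega>) (- int n) n (\<lambda>z. g z \<omega>) y" for \<omega>
  proof -
    have start: "- int (Suc n) = - int n - 1"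
      by simp
    show ?thesis
      unfolding mass_def start evolve_Suc_first g_def by (simp add: evolve_diff)
  qed
  moreover have "expectation (\<lambda>\<omega>. evolve x (\<lambda>i. a i \<omega>) (- int n) n (\<lambda>z. g z \<omega>) y * X \<omega>) = 0"
  proof (rule expectation_evolve_centred[OF _ _ X])
    show "seen {i. snd i < - int n} (g z)" for z
      unfolding g by (intro bounded_measurable_diff seen_a) auto
    show "expectation (g z) = 0" for z
      unfolding g using integrable_a by (simp add: mean)
  qed
  ultimately show "expectation (\<lambda>\<omega>. (mass (- int (Suc n)) (Suc n) y \<omega> - mass (- int n) n y \<omega>) * X \<omega>) = 0"
    by simp
qed

definition mass_limit :: "int \<Rightarrow> 'a \<Rightarrow> real" where
  "mass_limit y \<omega> = lim (\<lambda>n. mass (- int n) n y \<omega>)"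

lemma mass_measurable [measurable]: "mass s n y \<in> borel_measurable M"
  using seen_bounded_measurable[OF seen_mass[of s n UNIV y]] by (simp add: bounded_measurable_def)

lemma mass_limit_measurable [measurable]: "mass_limit y \<in> borel_measurable M"
  unfolding mass_limit_def by measurable

lemma AE_mass_tendsto: "AE \<omega> in M. (\<lambda>n. mass (- int n) n y \<omega>) \<longlonglongrightarrow> mass_limit y \<omega>"
  using bounded_martingale.AE_convergent[OF mass_martingale]
  by (simp add: mass_limit_def convergent_LIMSEQ_iff)

lemmas mass_L2 = bounded_martingale.L2_limit[OF mass_martingale mass_limit_measurable AE_mass_tendsto]

lemma expectation_mass: "expectation (mass s n y) = 1"
proof (induction n arbitrary: y)
  case 0
  show ?case by (simp add: mass_def prob_space)
next
  case (Suc n)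
  let ?past = "{i. snd i < s + int n}" and ?now = "{i. snd i = s + int n}"
  have past: "seen ?past (mass s n z)" for z
    by (rule seen_mass) auto
  have now: "seen ?now (\<lambda>\<omega>. 1 - a (z, s + int n) \<omega>)" "seen ?now (a (z, s + int n))" for z
    by (intro bounded_measurable_intros seen_a; simp)+
  have *: "expectation (\<lambda>\<omega>. mass s n z \<omega> * W \<omega>) = expectation W" "integrable M (\<lambda>\<omega>. mass s n z \<omega> * W \<omega>)"
    if "seen ?now W" for z W
  proof -
    show "expectation (\<lambda>\<omega>. mass s n z \<omega> * W \<omega>) = expectation W"
      using expectation_mult_disjoint[OF past that, of z] Suc.IH by force
    show "integrable M (\<lambda>\<omega>. mass s n z \<omega> * W \<omega>)"
      by (intro seen_integrable[of UNIV] bounded_measurable_mult seen_mono[OF that] seen_mass) auto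
  qed
  show ?case
    unfolding mass_Suc using now integrable_a by (simp add: * mean prob_space)
qed

lemma mass_limit_square_integrable: "integrable M (\<lambda>\<omega>. (mass_limit y \<omega>)\<^sup>2)"
  by (rule mass_L2)

lemma expectation_mass_limit: "expectation (mass_limit y) = 1"
proof -
  \<comment> \<open>Products with a constant sequence reduce convergence of means to that of products.\<close>
  have "(\<lambda>n. expectation (\<lambda>\<omega>. mass (- int n) n y \<omega> * 1)) \<longlonglongrightarrow> expectation (\<lambda>\<omega>. mass_limit y \<omega> * 1)"
    by (rule expectation_product_tendsto) (auto intro: mass_L2)
  then have "(\<lambda>n. 1) \<longlonglongrightarrow> expectation (mass_limit y)"
    by (simp add: expectation_mass)
  then show ?thesis
    by (simp add: LIMSEQ_const_iff)
qed

text \<open>The second moments of the martingale increase, which is the monotonicity at the origin that makes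
  the correlation recursion converge; convergence in \<open>L\<^sup>2\<close> lets the expectation pass to the limit.\<close>

lemma expectation_mass_limit_mult:
  assumes "y \<noteq> y'"
  shows "expectation (\<lambda>\<omega>. mass_limit y \<omega> * mass_limit y' \<omega>) = 1"
proof -
  let ?c = "pair_corr (jump_rate (q - v) (q * (1 - q)))"
  have "?c n 0 \<le> ?c (Suc n) 0" for n
    using bounded_martingale.second_moment_mono[OF mass_martingale, of n "Suc n" 0]
      pair_correlation[of "- int n" n 0 0] pair_correlation[of "- int (Suc n)" "Suc n" 0 0]
    by (simp add: power2_eq_square)
  then have "(\<lambda>n. ?c n (y' - y)) \<longlonglongrightarrow> 1"
    using assms by (intro pair_corr_tendsto_1 rates) auto
  moreover have "(\<lambda>n. expectation (\<lambda>\<omega>. mass (- int n) n y \<omega> * mass (- int n) n y' \<omega>))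
      \<longlonglongrightarrow> expectation (\<lambda>\<omega>. mass_limit y \<omega> * mass_limit y' \<omega>)"
    by (rule expectation_product_tendsto) (auto intro: mass_L2)
  ultimately show ?thesis
    unfolding pair_correlation by (metis LIMSEQ_unique)
qed

end

end

section \<open>Measurability of the density\<close>

lemma space_env_space: "space (env_space R) = environments R"
  by (simp add: env_space_def space_restrict_space)

lemma env_coordinate_measurable:
  "(\<lambda>\<omega>. \<omega> i) \<in> borel_measurable (env_space R)" "(\<lambda>\<omega>. \<omega> i z) \<in> borel_measurable (env_space R)"
proof -
  show *: "(\<lambda>\<omega>. \<omega> i) \<in> borel_measurable (env_space R)"
    unfolding env_space_def by (intro measurable_restrict_space1 measurable_product_coordinates)
  show "(\<lambda>\<omega>. \<omega> i z) \<in> borel_measurable (env_space R)"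
    by (rule measurable_compose[OF * measurable_product_coordinates])
qed

lemma environmentsD:
  assumes "\<omega> \<in> environments R"
  shows "0 \<le> \<omega> i z" "int R < \<bar>z\<bar> \<Longrightarrow> \<omega> i z = 0" "(\<Sum>z = - int R..int R. \<omega> i z) = 1"
proof -
  have "\<omega> i \<in> prob_vectors R"
    using assms by (cases i) (simp add: environments_def)
  then show "0 \<le> \<omega> i z" "int R < \<bar>z\<bar> \<Longrightarrow> \<omega> i z = 0" "(\<Sum>z = - int R..int R. \<omega> i z) = 1"
    by (auto simp: prob_vectors_def)
qed

lemma environment_sum_le:
  assumes "\<omega> \<in> environments R" "finite A"
  shows "sum (\<omega> i) A \<le> 1"
proof -
  have "sum (\<omega> i) A \<le> sum (\<omega> i) (A \<union> {- int R..int R})"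
    using assms by (intro sum_mono2) (auto intro: environmentsD)
  also have "\<dots> = sum (\<omega> i) {- int R..int R}"
    using assms by (intro sum.mono_neutral_right) (auto intro!: environmentsD(2)[OF assms(1)])
  also have "\<dots> = 1"
    using environmentsD(3)[OF assms(1)] .
  finally show ?thesis .
qed

lemma env_shift_in_environments: "\<omega> \<in> environments R \<Longrightarrow> env_shift m s \<omega> \<in> environments R"
  by (auto simp: environments_def env_shift_def)

lemma env_shift_measurable: "env_shift m s \<in> measurable (env_space R) (env_space R)"
proof -
  have "env_shift m s \<in> borel_measurable (env_space R)"
  proof (rule measurable_coordinatewise_then_product)
    fix i :: "int \<times> int"
    have "(\<lambda>\<omega>. env_shift m s \<omega> i) = (\<lambda>\<omega>. \<omega> (m + fst i, s + snd i))"
      by (simp add: env_shift_def case_prod_beta)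
    then show "(\<lambda>\<omega>. env_shift m s \<omega> i) \<in> borel_measurable (env_space R)"
      by (simp add: env_coordinate_measurable)
  qed
  then have "env_shift m s \<in> measurable (env_space R) (restrict_space borel (environments R))"
    by (intro measurable_restrict_space2) (auto simp: space_env_space env_shift_in_environments)
  then show ?thesis
    by (simp add: env_space_def)
qed

text \<open>Finite range makes the infinite sums over intermediate points finite. This is needed for
  measurability as well as for rearranging the sums.\<close>

lemma n_step_eq_0:
  assumes "\<omega> \<in> environments R"
  shows "int n * int R < \<bar>y - z\<bar> \<Longrightarrow> n_step \<omega> s n z y = 0"
proof (induction n arbitrary: y)
  case 0
  then show ?case by auto
next
  case (Suc n)
  have "n_step \<omega> s n z u * one_step \<omega> (s + int n) u y = 0" for u
  proof (cases "int n * int R < \<bar>u - z\<bar>")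
    case True
    then show ?thesis by (simp add: Suc.IH)
  next
    case False
    then have "int R < \<bar>y - u\<bar>"
      using Suc.prems by (simp add: algebra_simps)
    then show ?thesis
      using environmentsD(2)[OF assms] by (simp add: one_step_def)
  qed
  then show ?case
    unfolding n_step.simps by (rule infsum_0)
qed

lemma n_step_Suc_finite:
  assumes "\<omega> \<in> environments R"
  shows "n_step \<omega> s (Suc n) z y =
    (\<Sum>u = z - int n * int R..z + int n * int R. n_step \<omega> s n z u * \<omega> (u, s + int n) (y - u))"
proof -
  have "n_step \<omega> s (Suc n) z y =
      (\<Sum>\<^sub>\<infinity>u\<in>{z - int n * int R..z + int n * int R}. n_step \<omega> s n z u * \<omega> (u, s + int n) (y - u))"
    unfolding n_step.simps
    by (rule infsum_cong_neutral) (auto simp: one_step_def n_step_eq_0[OF assms])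
  then show ?thesis by simp
qed

lemma n_step_measurable: "(\<lambda>\<omega>. n_step \<omega> s n z y) \<in> borel_measurable (env_space R)"
proof (induction n arbitrary: y)
  case 0
  show ?case by simp
next
  case (Suc n)
  have "(\<lambda>\<omega>. \<Sum>u = z - int n * int R..z + int n * int R. n_step \<omega> s n z u * \<omega> (u, s + int n) (y - u))
      \<in> borel_measurable (env_space R)"
    by (intro borel_measurable_sum borel_measurable_times Suc.IH env_coordinate_measurable)
  then show ?case
    by (rule measurable_cong[THEN iffD2, rotated]) (simp add: space_env_space n_step_Suc_finite del: n_step.simps)
qed

lemma density_approx_measurable: "density_approx N \<in> borel_measurable (env_space R)"
proof -
  let ?A = "{- (int N * int R)..int N * int R}"
  have eq: "density_approx N \<omega> = (\<Sum>z\<in>?A. n_step \<omega> (- int N) N z 0)" if "\<omega> \<in> environments R" for \<omega>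
  proof -
    have "density_approx N \<omega> = (\<Sum>\<^sub>\<infinity>z\<in>?A. n_step \<omega> (- int N) N z 0)"
      unfolding density_approx_def trans_prob_def
      by (rule infsum_cong_neutral) (auto intro!: n_step_eq_0[OF that])
    then show ?thesis by simp
  qed
  have "(\<lambda>\<omega>. \<Sum>z\<in>?A. n_step \<omega> (- int N) N z 0) \<in> borel_measurable (env_space R)"
    by (intro borel_measurable_sum n_step_measurable)
  then show ?thesis
    by (rule measurable_cong[THEN iffD2, rotated]) (simp add: space_env_space eq)
qed

text \<open>Covariances are integrals with respect to the measure itself and not its completion, so almost sure
  equality with a measurable function does not suffice.\<close>

lemma env_density_measurable: "env_density \<in> borel_measurable (env_space R)"
  unfolding env_density_def[abs_def]
  by (intro borel_measurable_lim_metric) (simp add: density_approx_measurable)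

section \<open>Environments with two jumps\<close>

definition two_jumps :: "int \<Rightarrow> environment \<Rightarrow> bool" where
  "two_jumps x \<omega> \<longleftrightarrow> (\<forall>i. \<omega> i x + \<omega> i (x + 1) = 1)"

lemma two_jumps_eq_0:
  assumes "\<omega> \<in> environments R" "two_jumps x \<omega>" "z \<noteq> x" "z \<noteq> x + 1"
  shows "\<omega> i z = 0"
proof -
  have "sum (\<omega> i) {x, x + 1, z} \<le> 1"
    using assms(1) by (rule environment_sum_le) simp
  moreover have "sum (\<omega> i) {x, x + 1, z} = 1 + \<omega> i z"
    using assms(2)[unfolded two_jumps_def, rule_format, of i] assms(3,4) by simp
  ultimately show ?thesis
    using environmentsD(1)[OF assms(1), of i z] by simp
qed

text \<open>The column sum of the transition probabilities is the mass at \<open>y\<close> when every site starts with unit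
  mass, and with two jumps only the sites \<open>y - x\<close> and \<open>y - x - 1\<close> contribute to the last step.\<close>

lemma sum_n_step_eq_evolve:
  assumes env: "\<omega> \<in> environments R" and two: "two_jumps x \<omega>"
  shows "(\<Sum>\<^sub>\<infinity>z. n_step \<omega> s n z y) = evolve x (\<lambda>i. \<omega> i (x + 1)) s n (\<lambda>_. 1) y"
proof (induction n arbitrary: y)
  case 0
  have "(\<Sum>\<^sub>\<infinity>z. n_step \<omega> s 0 z y) = (\<Sum>\<^sub>\<infinity>z\<in>{y}. 1)"
    by (rule infsum_cong_neutral) auto
  then show ?case by simp
next
  case (Suc n)
  have summable: "(\<lambda>z. n_step \<omega> s n z u) summable_on UNIV" for u
  proof (rule finite_nonzero_values_imp_summable_on, rule finite_subset)
    show "{z \<in> UNIV. n_step \<omega> s n z u \<noteq> 0} \<subseteq> {u - int n * int R..u + int n * int R}"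
    proof
      fix z assume "z \<in> {z \<in> UNIV. n_step \<omega> s n z u \<noteq> 0}"
      then have "\<not> int n * int R < \<bar>u - z\<bar>"
        using n_step_eq_0[OF env] by blast
      then show "z \<in> {u - int n * int R..u + int n * int R}"
        by auto
    qed
  qed simp
  let ?t = "s + int n"
  have right: "\<omega> i x = 1 - \<omega> i (x + 1)" for i
    using two unfolding two_jumps_def by (metis add_diff_cancel_right')
  have step: "n_step \<omega> s (Suc n) z y = n_step \<omega> s n z (y - x) * (1 - \<omega> (y - x, ?t) (x + 1))
      + n_step \<omega> s n z (y - x - 1) * \<omega> (y - x - 1, ?t) (x + 1)" for z
  proof -
    have "n_step \<omega> s (Suc n) z y =
        (\<Sum>\<^sub>\<infinity>u\<in>{y - x, y - x - 1}. n_step \<omega> s n z u * \<omega> (u, ?t) (y - u))"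
      unfolding n_step.simps one_step_def
    proof (rule infsum_cong_neutral)
      fix u assume "u \<in> UNIV - {y - x, y - x - 1}"
      then have "y - u \<noteq> x" "y - u \<noteq> x + 1"
        by auto
      then show "n_step \<omega> s n z u * \<omega> (u, ?t) (y - u) = 0"
        using two_jumps_eq_0[OF env two] by simp
    qed auto
    also have "\<dots> = n_step \<omega> s n z (y - x) * \<omega> (y - x, ?t) x
        + n_step \<omega> s n z (y - x - 1) * \<omega> (y - x - 1, ?t) (x + 1)"
      by (simp add: algebra_simps)
    finally show ?thesis
      by (simp only: right)
  qed
  have "(\<Sum>\<^sub>\<infinity>z. n_step \<omega> s (Suc n) z y) =
      (\<Sum>\<^sub>\<infinity>z. n_step \<omega> s n z (y - x)) * (1 - \<omega> (y - x, ?t) (x + 1))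
      + (\<Sum>\<^sub>\<infinity>z. n_step \<omega> s n z (y - x - 1)) * \<omega> (y - x - 1, ?t) (x + 1)"
    unfolding step
    by (subst infsum_add) (auto simp only: infsum_cmult_left' intro!: summable_on_cmult_left summable)
  then show ?case
    by (simp add: Suc.IH push_def del: n_step.simps)
qed

lemma two_jumps_env_shift: "two_jumps x \<omega> \<Longrightarrow> two_jumps x (env_shift m s \<omega>)"
  by (simp add: two_jumps_def env_shift_def split: prod.split)

lemma evolve_env_shift:
  "evolve x (\<lambda>i. env_shift m 0 \<omega> i u) s n (\<lambda>_. 1) y = evolve x (\<lambda>i. \<omega> i u) s n (\<lambda>_. 1) (m + y)"
proof (induction n arbitrary: y)
  case 0
  show ?case by simp
next
  case (Suc n)
  have assoc: "m + (y - x) = m + y - x" "m + (y - x - 1) = m + y - x - 1"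
    by auto
  have site: "env_shift m 0 \<omega> (z, t) = \<omega> (m + z, t)" for z t
    by (simp add: env_shift_def)
  show ?case
    unfolding evolve.simps push_def Suc.IH by (simp only: assoc site)
qed

lemma density_approx_shift:
  assumes "\<omega> \<in> environments R" "two_jumps x \<omega>"
  shows "density_approx N (env_shift m 0 \<omega>) = evolve x (\<lambda>i. \<omega> i (x + 1)) (- int N) N (\<lambda>_. 1) m"
  unfolding density_approx_def trans_prob_def
  using sum_n_step_eq_evolve[OF env_shift_in_environments[OF assms(1)] two_jumps_env_shift[OF assms(2)],
      where s = "- int N" and n = N and y = 0]
  by (simp add: evolve_env_shift)

locale two_jump_environment = prob_space P for P :: "environment measure" +
  fixes R :: nat and x :: int
  assumes sets_P: "sets P = sets (env_space R)"
    and iid: "iid_environment P"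
    and random: "random_environment P"
    and two_means: "mean_step P x + mean_step P (x + 1) = 1"
begin

lemma space_P: "space P = environments R"
  using sets_eq_imp_space_eq[OF sets_P] by (simp add: space_env_space)

lemma measurable_P: "measurable P N = measurable (env_space R) N"
  by (rule measurable_cong_sets[OF sets_P refl])

lemma coordinate_measurable [measurable]:
  "(\<lambda>\<omega>. \<omega> i) \<in> borel_measurable P" "(\<lambda>\<omega>. \<omega> i z) \<in> borel_measurable P"
  by (simp_all add: measurable_P env_coordinate_measurable)

lemma coordinate_le_one: "\<omega> \<in> space P \<Longrightarrow> \<omega> i z \<le> 1"
  using environment_sum_le[of \<omega> R "{z}" i] by (simp add: space_P)

lemma coordinate_nonneg: "\<omega> \<in> space P \<Longrightarrow> 0 \<le> \<omega> i z"
  by (simp add: space_P environmentsD)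

lemma coordinate_integrable: "integrable P (\<lambda>\<omega>. \<omega> i z)" "integrable P (\<lambda>\<omega>. (\<omega> i z)\<^sup>2)"
proof -
  show "integrable P (\<lambda>\<omega>. \<omega> i z)"
    by (rule integrable_const_bound[where B = 1]) (auto simp: coordinate_le_one coordinate_nonneg)
  show "integrable P (\<lambda>\<omega>. (\<omega> i z)\<^sup>2)"
    by (rule integrable_const_bound[where B = 1])
      (auto simp: coordinate_le_one coordinate_nonneg power_le_one)
qed

lemma expectation_site:
  fixes g :: "(int \<Rightarrow> real) \<Rightarrow> real"
  assumes [measurable]: "g \<in> borel_measurable borel"
  shows "expectation (\<lambda>\<omega>. g (\<omega> i)) = expectation (\<lambda>\<omega>. g (\<omega> (0, 0)))"
proof -
  have "integral\<^sup>L (distr P borel (\<lambda>\<omega>. \<omega> i)) g = integral\<^sup>L (distr P borel (\<lambda>\<omega>. \<omega> (0, 0))) g"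
    using iid unfolding iid_environment_def by metis
  then show ?thesis
    by (simp add: integral_distr)
qed

text \<open>The mean of \<open>\<omega> i x + \<omega> i (x + 1)\<close> is 1 and its values are at most 1.\<close>

lemma AE_two_jumps: "AE \<omega> in P. two_jumps x \<omega>"
  unfolding two_jumps_def AE_all_countable
proof
  fix i
  have "expectation (\<lambda>\<omega>. \<omega> i z) = mean_step P z" for z
    unfolding mean_step_def by (rule expectation_site) (rule measurable_product_coordinates)
  then have "expectation (\<lambda>\<omega>. 1 - (\<omega> i x + \<omega> i (x + 1))) = 0"
    using two_means coordinate_integrable by (simp add: prob_space)
  moreover have "0 \<le> 1 - (\<omega> i x + \<omega> i (x + 1))" if "\<omega> \<in> space P" for \<omega>
    using environment_sum_le[of \<omega> R "{x, x + 1}" i] that by (simp add: space_P)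
  moreover have "integrable P (\<lambda>\<omega>. 1 - (\<omega> i x + \<omega> i (x + 1)))"
    using coordinate_integrable by simp
  ultimately have "AE \<omega> in P. 1 - (\<omega> i x + \<omega> i (x + 1)) = 0"
    by (subst (asm) integral_nonneg_eq_0_iff_AE) auto
  then show "AE \<omega> in P. \<omega> i x + \<omega> i (x + 1) = 1"
    by eventually_elim simp
qed

text \<open>Equality would make the two jumps deterministic at the origin: \<open>a - a\<^sup>2\<close> is non-negative for
  \<open>a \<in> [0, 1]\<close> and vanishes only at the end points.\<close>

lemma random_step: "expectation (\<lambda>\<omega>. (\<omega> (0, 0) (x + 1))\<^sup>2) < expectation (\<lambda>\<omega>. \<omega> (0, 0) (x + 1))"
proof -
  let ?a = "\<lambda>\<omega>. \<omega> (0, 0) (x + 1)"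
  have le: "0 \<le> ?a \<omega> - (?a \<omega>)\<^sup>2" if "\<omega> \<in> space P" for \<omega>
    using coordinate_nonneg[OF that] coordinate_le_one[OF that] by (simp add: power2_eq_square mult_left_le)
  have int: "integrable P (\<lambda>\<omega>. ?a \<omega> - (?a \<omega>)\<^sup>2)"
    using coordinate_integrable by simp
  have "expectation (\<lambda>\<omega>. ?a \<omega> - (?a \<omega>)\<^sup>2) \<noteq> 0"
  proof
    assume "expectation (\<lambda>\<omega>. ?a \<omega> - (?a \<omega>)\<^sup>2) = 0"
    then have "AE \<omega> in P. ?a \<omega> - (?a \<omega>)\<^sup>2 = 0"
      using int le by (subst (asm) integral_nonneg_eq_0_iff_AE) auto
    with AE_two_jumps have "AE \<omega> in P. \<not> (\<exists>z. 0 < \<omega> (0, 0) z \<and> \<omega> (0, 0) z < 1)"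
      using AE_space
    proof eventually_elim
      case (elim \<omega>)
      have "?a \<omega> = 0 \<or> ?a \<omega> = 1"
        using elim(2) by (simp add: power2_eq_square)
      moreover have "\<omega> (0, 0) x = 1 - ?a \<omega>"
        using elim(1) unfolding two_jumps_def by (metis add_diff_cancel_right')
      moreover have "\<omega> (0, 0) z = 0" if "z \<noteq> x" "z \<noteq> x + 1" for z
        using two_jumps_eq_0[OF _ elim(1) that] elim(3) by (simp add: space_P)
      ultimately have "\<omega> (0, 0) z = 0 \<or> \<omega> (0, 0) z = 1" for z
        by (cases "z = x"; cases "z = x + 1") auto
      then show ?case
        by (metis less_irrefl)
    qed
    moreover have "{\<omega> \<in> space P. \<exists>z. 0 < \<omega> (0, 0) z \<and> \<omega> (0, 0) z < 1} \<in> events"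
      by measurable
    ultimately have "prob {\<omega> \<in> space P. \<exists>z. 0 < \<omega> (0, 0) z \<and> \<omega> (0, 0) z < 1} = 0"
      by (subst prob_eq_0) simp_all
    then show False
      using random by (simp add: random_environment_def)
  qed
  moreover have "0 \<le> expectation (\<lambda>\<omega>. ?a \<omega> - (?a \<omega>)\<^sup>2)"
    using le by (intro Bochner_Integration.integral_nonneg_AE AE_I2)
  ultimately show ?thesis
    using coordinate_integrable by simp
qed

sublocale iid_jump_field P "\<lambda>i \<omega>. \<omega> i (x + 1)" "mean_step P (x + 1)"
  "expectation (\<lambda>\<omega>. (\<omega> (0, 0) (x + 1))\<^sup>2)"
proof
  have "indep_vars (\<lambda>_. borel) (\<lambda>i \<omega>. \<omega> i) UNIV"
    using iid unfolding iid_environment_def by blast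
  then show "indep_vars (\<lambda>_. borel) (\<lambda>i \<omega>. \<omega> i (x + 1)) UNIV"
    by (rule indep_vars_compose2) (rule measurable_product_coordinates)
  show "0 \<le> \<omega> i (x + 1)" "\<omega> i (x + 1) \<le> 1" if "\<omega> \<in> space P" for \<omega> i
    using that by (rule coordinate_nonneg, rule coordinate_le_one)
  show "expectation (\<lambda>\<omega>. \<omega> i (x + 1)) = mean_step P (x + 1)" for i
    unfolding mean_step_def by (rule expectation_site) (rule measurable_product_coordinates)
  show "expectation (\<lambda>\<omega>. (\<omega> i (x + 1))\<^sup>2) = expectation (\<lambda>\<omega>. (\<omega> (0, 0) (x + 1))\<^sup>2)" for i
    by (rule expectation_site) (intro borel_measurable_power measurable_product_coordinates)
  show "expectation (\<lambda>\<omega>. (\<omega> (0, 0) (x + 1))\<^sup>2) < mean_step P (x + 1)"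
    unfolding mean_step_def by (rule random_step)
qed

lemma AE_env_density_shift: "AE \<omega> in P. env_density (env_shift m 0 \<omega>) = mass_limit x m \<omega>"
  using AE_two_jumps AE_space
proof eventually_elim
  case (elim \<omega>)
  then show ?case
    unfolding env_density_def mass_limit_def mass_def
    by (simp add: density_approx_shift space_P)
qed

lemma env_density_shift_measurable: "(\<lambda>\<omega>. env_density (env_shift m 0 \<omega>)) \<in> borel_measurable P"
  unfolding measurable_P by (rule measurable_compose[OF env_shift_measurable env_density_measurable])

lemma expectation_env_density_shift: "expectation (\<lambda>\<omega>. env_density (env_shift m 0 \<omega>)) = 1"
  using integral_cong_AE[OF env_density_shift_measurable mass_limit_measurable AE_env_density_shift]
  by (simp add: expectation_mass_limit)

lemma covariance_env_density:
  assumes "m \<noteq> 0"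
  shows "covariance P env_density (\<lambda>\<omega>. env_density (env_shift m 0 \<omega>)) = 0"
proof -
  \<comment> \<open>Written as a shift by 0, the first factor is covered by the lemmas on shifted densities.\<close>
  have origin: "env_density = (\<lambda>\<omega>. env_density (env_shift 0 0 \<omega>))"
    by (simp add: env_shift_def)
  have "covariance P env_density (\<lambda>\<omega>. env_density (env_shift m 0 \<omega>)) =
      expectation (\<lambda>\<omega>. (env_density (env_shift 0 0 \<omega>) - 1) * (env_density (env_shift m 0 \<omega>) - 1))"
    unfolding covariance_def
    by (subst (1 2) origin) (simp add: expectation_env_density_shift)
  also have "\<dots> = expectation (\<lambda>\<omega>. (mass_limit x 0 \<omega> - 1) * (mass_limit x m \<omega> - 1))"
  proof (rule integral_cong_AE)
    show "AE \<omega> in P. (env_density (env_shift 0 0 \<omega>) - 1) * (env_density (env_shift m 0 \<omega>) - 1)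
        = (mass_limit x 0 \<omega> - 1) * (mass_limit x m \<omega> - 1)"
      using AE_env_density_shift[of 0] AE_env_density_shift[of m] by eventually_elim simp
  qed (intro borel_measurable_times borel_measurable_diff borel_measurable_const
      env_density_shift_measurable mass_limit_measurable)+
  also have "\<dots> = expectation (\<lambda>\<omega>. mass_limit x 0 \<omega> * mass_limit x m \<omega> - mass_limit x 0 \<omega> - mass_limit x m \<omega> + 1)"
    by (simp add: algebra_simps)
  also have "\<dots> = expectation (\<lambda>\<omega>. mass_limit x 0 \<omega> * mass_limit x m \<omega>)
      - expectation (mass_limit x 0) - expectation (mass_limit x m) + 1"
  proof -
    have "integrable P (mass_limit x y)" for y
      by (rule square_integrable_imp_integrable[OF mass_limit_measurable mass_limit_square_integrable])
    moreover have "integrable P (\<lambda>\<omega>. mass_limit x 0 \<omega> * mass_limit x m \<omega>)"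
      by (intro Cauchy_Schwarz_expectation mass_limit_measurable mass_limit_square_integrable)
    ultimately show ?thesis
      by (simp add: prob_space)
  qed
  also have "\<dots> = 0"
    using assms by (simp add: expectation_mass_limit expectation_mass_limit_mult)
  finally show ?thesis .
qed

end

theorem corollary1p3:
  fixes R :: nat and P :: "environment measure"
  assumes "prob_space P"
    and "sets P = sets (env_space R)"
    and "iid_environment P"
    and "random_environment P"
    and "aperiodic_walk P"
    and "\<exists>x. mean_step P x + mean_step P (x + 1) = 1"
  shows "\<forall>m. m \<noteq> 0 \<longrightarrow> covariance P env_density (\<lambda>\<omega>. env_density (env_shift m 0 \<omega>)) = 0"
proof (intro allI impI)
  fix m :: int
  assume "m \<noteq> 0"
  obtain x where "mean_step P x + mean_step P (x + 1) = 1"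
    using assms(6) by blast
  with assms(1-4) interpret two_jump_environment P R x
    by (simp add: two_jump_environment_def two_jump_environment_axioms_def)
  show "covariance P env_density (\<lambda>\<omega>. env_density (env_shift m 0 \<omega>)) = 0"
    using \<open>m \<noteq> 0\<close> by (rule covariance_env_density)
qed

end
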